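(* Let $d \ge 3$ and let $\mathcal{P}$ be a family of absolutely continuous multivariate Pareto distributions in dimension $d$ that forms a pairwise interaction model (with common support $\mathcal{Y} = \mathcal{L} := [0,\infty)^d \setminus [0,1]^d$). Then $\mathcal{P}$ is a subset of the H\"usler--Reiss family, i.e., every member of $\mathcal{P}$ is a H\"usler--Reiss distribution.
   Context: Multivariate Pareto distributions. Let $\mathcal{L} := [0,\infty)^d \setminus [0,1]^d$. An absolutely continuous random vector $\mathbf{Y} = (Y_1,\dots,Y_d)$ with Lebesgue density $f$ has a multivariate Pareto distribution if: (MP1) it is supported on $\mathcal{L}$, i.e., $f(\mathbf{y}) = 0$ for $\mathbf{y} \notin \mathcal{L}$; (MP2) $f(t\mathbf{y}) = t^{-(d+1)} f(\mathbf{y})$ for $\mathbf{y} \in \mathcal{L}$ and $t \ge 1$; (MP3) the probabilities $P(Y_k > 1)$, $k \in \{1,\dots,d\}$, are equal to each other. Pairwise interaction models. Let $\mathcal{S}^{d\times d}$ be the space of real symmetric $d \times d$ matrices and let $q \in \mathbb{N}$, $q \geq 1$. A (possibly curved) exponential family of probability distributions supported on a common set $\mathcal{Y} \subseteq \mathbb{R}^d$ and indexed by a parameter space $\Omega \subseteq (\mathbb{R}^q)^d \times \mathcal{S}^{d\times d}$ is called a pairwise interaction model if: (PI1) it corresponds to a family of Lebesgue densities on $\mathcal{Y}$ (zero outside $\mathcal{Y}$) $$\mathbf{y} \mapsto f_{\mu,\Theta}(\mathbf{y}) = \frac{1}{Z(\mu,\Theta)} \exp\Big\{ -\sum_{i=1}^d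 \mu_i^\top S_i(y_i) - \sum_{i=1}^d \sum_{j=1}^d \Theta_{ij} T_i(y_i) T_j(y_j) \Big\}, \quad (\mu,\Theta) \in \Omega,$$ for some measurable functions $S_i: \mathbb{R} \to \mathbb{R}^q$ and measurable, non-constant functions $T_i : \mathbb{R} \to \mathbb{R}$ (the same for all parameters), where $\mu = (\mu_1,\dots,\mu_d)$ with $\mu_i \in \mathbb{R}^q$ and $Z(\mu,\Theta) \in (0,\infty)$ is the normalizing constant; and (PI2) for every pair $(i,j)$, $i \ne j$, there exists at least one $(\mu,\Theta) \in \Omega$ such that $\Theta_{ij} \neq 0$. No regularity of $\Omega$ is assumed. H\"usler--Reiss family. Let $\mathbf{1}$ be the vector of ones, and let $\log \mathbf{y} := (\log y_1, \dots, \log y_d)$. Let $\mathcal{S}_{\mathbf 1,+}^{d\times d}$ be the set of symmetric positive semi-definite $d \times d$ matrices $\Theta$ of rank $d-1$ with $\Theta \mathbf{1} = 0$. For $\Theta \in \mathcal{S}_{\mathbf 1,+}^{d\times d}$, let $\Theta^+$ be its Moore--Penrose pseudoinverse, let $\mathrm{diag}(\Theta^+)$ be the column vector of diagonal entries of $\Theta^+$, let $\Gamma := \mathbf{1}\,\mathrm{diag}(\Theta^+)^\top + \mathrm{diag}(\Theta^+)\mathbf{1}^\top - 2\Theta^+$, and let $$\mu_{\rm HR}(\Theta) := \big(1 + \tfrac{1}{d}\big)\mathbf{1} + \tfrac{1}{2d}\,\Theta\Gamma\mathbf{1}.$$ The H\"usler--Reiss distribution with precision matrix $\Theta$ is the multivariate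 Pareto distribution with density $$f(\mathbf{y}) \propto \exp\big\{ -\mu_{\rm HR}(\Theta)^\top (\log \mathbf{y}) - (\log \mathbf{y})^\top \Theta (\log \mathbf{y}) \big\}, \quad \mathbf{y} \in \mathcal{L}.$$ The H\"usler--Reiss family is the set of all these distributions as $\Theta$ ranges over $\mathcal{S}_{\mathbf 1,+}^{d\times d}$. Formulas involving $\log\mathbf{y}$ are understood for $\mathbf{y} \in \mathcal{L}$ with all coordinates positive (the remaining points form a Lebesgue null set), and densities are identified up to Lebesgue null sets. *)

theory Defs
  imports "HOL-Probability.Probability"
begin

text \<open>The dimension \<open>d\<close> is \<open>CARD('d)\<close>.  Probability distributions on \<open>d\<close>-dimensional space are
  represented by their laws, i.e. measures on \<^typ>\<open>real ^ 'd\<close>; since a law is given by its density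
  only up to null sets, this identifies densities that agree almost everywhere.\<close>

subsection \<open>Multivariate Pareto distributions\<close>

text \<open>The order on vectors is componentwise, and \<open>1\<close> is the vector of ones.\<close>

definition pareto_support :: "(real ^ 'd) set"
  where "pareto_support = {0..} - {0..1}"

text \<open>The conditions on the density are required pointwise, but only of some version of it.\<close>

definition multivariate_pareto :: "(real ^ 'd) measure \<Rightarrow> bool"
  where "multivariate_pareto M \<longleftrightarrow>
    prob_space M \<and>
    (\<exists>f. f \<in> borel_measurable borel \<and> (\<forall>y. 0 \<le> f y) \<and>
      M = density lborel (\<lambda>y. ennreal (f y)) \<and>
      (\<forall>y. y \<notin> pareto_support \<longrightarrow> f y = 0) \<and>
      (\<forall>y\<in>pareto_support. \<forall>t\<ge>1. f (t *\<^sub>R y) = f y / t ^ (CARD('d) + 1))) \<and>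
    (\<forall>k l. measure M {y. 1 < y $ k} = measure M {y. 1 < y $ l})"

subsection \<open>Pairwise interaction models\<close>

definition pairwise_weight ::
  "('d \<Rightarrow> real \<Rightarrow> real ^ 'q) \<Rightarrow> ('d \<Rightarrow> real \<Rightarrow> real) \<Rightarrow> real ^ 'q ^ 'd \<Rightarrow> real ^ 'd ^ 'd \<Rightarrow>
    real ^ 'd \<Rightarrow> real"
  where "pairwise_weight S T \<mu> \<Theta> y =
    exp (- (\<Sum>i\<in>UNIV. \<mu> $ i \<bullet> S i (y $ i))
         - (\<Sum>i\<in>UNIV. \<Sum>j\<in>UNIV. \<Theta> $ i $ j * T i (y $ i) * T j (y $ j)))"

definition pairwise_Z ::
  "(real ^ 'd) set \<Rightarrow> ('d \<Rightarrow> real \<Rightarrow> real ^ 'q) \<Rightarrow> ('d \<Rightarrow> real \<Rightarrow> real) \<Rightarrow>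
    real ^ 'q ^ 'd \<Rightarrow> real ^ 'd ^ 'd \<Rightarrow> real"
  where "pairwise_Z Y S T \<mu> \<Theta> = (LINT y:Y|lborel. pairwise_weight S T \<mu> \<Theta> y)"

definition pairwise_law ::
  "(real ^ 'd) set \<Rightarrow> ('d \<Rightarrow> real \<Rightarrow> real ^ 'q) \<Rightarrow> ('d \<Rightarrow> real \<Rightarrow> real) \<Rightarrow>
    real ^ 'q ^ 'd \<Rightarrow> real ^ 'd ^ 'd \<Rightarrow> (real ^ 'd) measure"
  where "pairwise_law Y S T \<mu> \<Theta> = density lborel
    (\<lambda>y. ennreal (indicator Y y * (pairwise_weight S T \<mu> \<Theta> y / pairwise_Z Y S T \<mu> \<Theta>)))"

text \<open>The family \<open>P\<close> of laws is the pairwise interaction model on \<open>Y\<close> with sufficient statistics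
  \<open>S\<close>, \<open>T\<close> and parameter space \<open>\<Omega>\<close>.  The number \<open>q\<close> is \<open>CARD('q)\<close>, and \<open>\<mu> $ i\<close> is the parameter
  of the \<open>i\<close>-th coordinate.\<close>

definition pairwise_interaction_model ::
  "(real ^ 'd) set \<Rightarrow> ('d \<Rightarrow> real \<Rightarrow> real ^ 'q) \<Rightarrow> ('d \<Rightarrow> real \<Rightarrow> real) \<Rightarrow>
    ((real ^ 'q ^ 'd) \<times> (real ^ 'd ^ 'd)) set \<Rightarrow> (real ^ 'd) measure set \<Rightarrow> bool"
  where "pairwise_interaction_model Y S T \<Omega> P \<longleftrightarrow>
    (\<forall>i. S i \<in> borel_measurable borel) \<and>
    (\<forall>i. T i \<in> borel_measurable borel \<and> \<not> T i constant_on UNIV) \<and>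
    (\<forall>(\<mu>, \<Theta>)\<in>\<Omega>. transpose \<Theta> = \<Theta>) \<and>
    (\<forall>(\<mu>, \<Theta>)\<in>\<Omega>. set_integrable lborel Y (pairwise_weight S T \<mu> \<Theta>) \<and> 0 < pairwise_Z Y S T \<mu> \<Theta>) \<and>
    P = {pairwise_law Y S T \<mu> \<Theta> | \<mu> \<Theta>. (\<mu>, \<Theta>) \<in> \<Omega>} \<and>
    (\<forall>i j. i \<noteq> j \<longrightarrow> (\<exists>(\<mu>, \<Theta>)\<in>\<Omega>. \<Theta> $ i $ j \<noteq> 0))"

subsection \<open>The Huesler--Reiss family\<close>

definition penrose_inverse :: "real ^ 'n ^ 'm \<Rightarrow> real ^ 'm ^ 'n \<Rightarrow> bool"
  where "penrose_inverse A X \<longleftrightarrow>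
    A ** X ** A = A \<and> X ** A ** X = X \<and>
    transpose (A ** X) = A ** X \<and> transpose (X ** A) = X ** A"

lemma penrose_inverse_unique:
  assumes "penrose_inverse A X" "penrose_inverse A Y"
  shows "X = Y"
proof -
  have "A ** X = transpose X ** transpose A" "A ** Y = transpose Y ** transpose A"
    "X ** A = transpose A ** transpose X" "Y ** A = transpose A ** transpose Y"
    using assms by (metis matrix_transpose_mul penrose_inverse_def)+
  note t = this
  have "A ** X = transpose X ** transpose (A ** Y ** A)"
    using assms t(1) by (simp add: penrose_inverse_def)
  also have "\<dots> = transpose X ** transpose A ** transpose (A ** Y)"
    by (simp add: matrix_transpose_mul matrix_mul_assoc)
  also have "\<dots> = A ** X ** (A ** Y)"
    using assms t(1) by (simp add: penrose_inverse_def)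
  also have "\<dots> = A ** Y"
    using assms by (simp add: penrose_inverse_def matrix_mul_assoc)
  finally have AX: "A ** X = A ** Y" .
  have "X ** A = transpose (A ** Y ** A) ** transpose X"
    using assms t(3) by (simp add: penrose_inverse_def)
  also have "\<dots> = transpose (Y ** A) ** (transpose A ** transpose X)"
    by (simp add: matrix_transpose_mul matrix_mul_assoc)
  also have "\<dots> = Y ** A ** (X ** A)"
    using assms t(3) by (simp add: penrose_inverse_def)
  also have "\<dots> = Y ** (A ** X ** A)"
    by (simp add: matrix_mul_assoc)
  also have "\<dots> = Y ** A"
    using assms by (simp add: penrose_inverse_def)
  finally have XA: "X ** A = Y ** A" .
  have "X = X ** A ** X" using assms by (simp add: penrose_inverse_def)
  also have "\<dots> = Y ** (A ** X)" by (simp add: XA matrix_mul_assoc)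
  also have "\<dots> = Y ** A ** Y" by (simp add: AX matrix_mul_assoc)
  also have "\<dots> = Y" using assms by (simp add: penrose_inverse_def)
  finally show ?thesis .
qed

definition pinv :: "real ^ 'n ^ 'm \<Rightarrow> real ^ 'm ^ 'n"
  where "pinv A = (THE X. penrose_inverse A X)"

lemma pinv_eqI: "penrose_inverse A X \<Longrightarrow> pinv A = X"
  unfolding pinv_def using penrose_inverse_unique by (intro the_equality) blast+

definition hr_precision_matrices :: "(real ^ 'd ^ 'd) set"
  where "hr_precision_matrices =
    {\<Theta>. transpose \<Theta> = \<Theta> \<and> (\<forall>x. 0 \<le> x \<bullet> (\<Theta> *v x)) \<and> rank \<Theta> = CARD('d) - 1 \<and> \<Theta> *v 1 = 0}"

text \<open>Entrywise form of \<open>1 diag(\<Theta>\<^sup>+)\<^sup>T + diag(\<Theta>\<^sup>+) 1\<^sup>T - 2 \<Theta>\<^sup>+\<close>.\<close>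

definition hr_variogram :: "real ^ 'd ^ 'd \<Rightarrow> real ^ 'd ^ 'd"
  where "hr_variogram \<Theta> = (\<chi> i j. pinv \<Theta> $ j $ j + pinv \<Theta> $ i $ i - 2 * pinv \<Theta> $ i $ j)"

definition hr_mu :: "real ^ 'd ^ 'd \<Rightarrow> real ^ 'd"
  where "hr_mu \<Theta> = (1 + 1 / real CARD('d)) *\<^sub>R 1 +
    (1 / (2 * real CARD('d))) *\<^sub>R (\<Theta> *v (hr_variogram \<Theta> *v 1))"

text \<open>As \<open>ln 0 = 0\<close>, the formula has a junk value at points with a zero coordinate; these form a
  null set.\<close>

definition hr_weight :: "real ^ 'd ^ 'd \<Rightarrow> real ^ 'd \<Rightarrow> real"
  where "hr_weight \<Theta> y = (let x = (\<chi> i. ln (y $ i)) in exp (- (hr_mu \<Theta> \<bullet> x) - x \<bullet> (\<Theta> *v x)))"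

definition hr_distribution :: "real ^ 'd ^ 'd \<Rightarrow> (real ^ 'd) measure \<Rightarrow> bool"
  where "hr_distribution \<Theta> M \<longleftrightarrow>
    multivariate_pareto M \<and>
    (\<exists>c>0. M = density lborel (\<lambda>y. ennreal (indicator pareto_support y * (c * hr_weight \<Theta> y))))"

definition hr_family :: "(real ^ 'd) measure set"
  where "hr_family = {M. \<exists>\<Theta>\<in>hr_precision_matrices. hr_distribution \<Theta> M}"

end

theory Submission
  imports Defs
begin

text \<open>Write \<open>exp (- H)\<close> for the unnormalized density, so that homogeneity reads
  \<open>H (t y) = H y + (d + 1) ln t\<close>.  Since \<open>d \<ge> 3\<close>, a third coordinate above \<open>1\<close> keeps the point in the
  support while \<open>y\<^sub>i\<close> and \<open>y\<^sub>j\<close> vary freely; the mixed second difference of \<open>H\<close> in them is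
  \<open>2 \<Theta>\<^sub>i\<^sub>j\<close> times the product of the increments of \<open>T\<^sub>i\<close> and \<open>T\<^sub>j\<close>, and it is invariant under dilation.
  Comparing three coordinates, the increments of each \<open>T\<^sub>i\<close> are themselves invariant, whence
  \<open>T\<^sub>i = \<alpha>\<^sub>i ln + \<beta>\<^sub>i\<close> almost everywhere.  Homogeneity then determines the \<open>S\<close>-terms up to a linear
  function of \<open>ln y\<^sub>i\<close>, so \<open>H\<close> becomes \<open>\<nu> \<bullet> ln y + ln y \<bullet> \<Theta> ln y\<close> with \<open>\<Theta> 1 = 0\<close>.
  Integrability forces \<open>\<Theta>\<close> to be positive on the complement of \<open>1\<close>: along a nonpositive direction the
  diagonal dilations would produce infinitely many disjoint sets of at least the same mass.  Finally
  the mass of \<open>{y\<^sub>k > 1}\<close> is an integral of \<open>y\<^sub>k exp (- H y)\<close> over a slab transversal to the diagonal,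
  and translating by \<open>\<Theta>\<^sup>+ (e\<^sub>l - e\<^sub>k) / 2\<close> in logarithmic coordinates compares these masses and
  identifies \<open>\<nu>\<close>.\<close>

subsection \<open>Null sets and coordinates\<close>

definition upd :: "real ^ 'd \<Rightarrow> 'd \<Rightarrow> real \<Rightarrow> real ^ 'd"
  where "upd y i a = (\<chi> k. if k = i then a else y $ k)"

lemma upd_nth [simp]: "upd y i a $ k = (if k = i then a else y $ k)"
  by (simp add: upd_def)

lemma AE_lborel_iff_negligible:
  fixes P :: "'a::euclidean_space \<Rightarrow> bool"
  shows "(AE x in lborel. P x) \<longleftrightarrow> negligible {x. \<not> P x}"
  using completion.AE_iff_null_sets[of P lborel]
  by (simp add: AE_completion_iff negligible_iff_null_sets)

text \<open>Linear self-maps are differentiable and so send null sets to null sets; by surjectivity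
  the image of the exceptional set of \<open>P \<circ> f\<close> covers that of
  \<open>P\<close>.\<close>

lemma AE_lborel_linear_image:
  fixes f :: "'a::euclidean_space \<Rightarrow> 'a"
  assumes "AE x in lborel. P (f x)" "linear f" "surj f"
  shows "AE x in lborel. P x"
proof -
  have "negligible (f ` {x. \<not> P (f x)})"
    using assms by (intro negligible_differentiable_image_negligible)
      (auto simp: AE_lborel_iff_negligible linear_imp_differentiable_on)
  then show ?thesis
    unfolding AE_lborel_iff_negligible
    by (rule negligible_subset) (use assms(3) in \<open>fastforce simp: image_iff elim: surjE\<close>)
qed

lemma AE_lborel_scaleR:
  fixes P :: "'a::euclidean_space \<Rightarrow> bool"
  assumes "AE x in lborel. P x" "t \<noteq> 0"
  shows "AE x in lborel. P (t *\<^sub>R x)"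
proof (rule AE_lborel_linear_image)
  show "AE x in lborel. P (t *\<^sub>R (inverse t *\<^sub>R x))" using assms by simp
  show "linear (\<lambda>x::'a. inverse t *\<^sub>R x)" by (rule linear_scale_self)
  show "surj (\<lambda>x::'a. inverse t *\<^sub>R x)"
    by (metis assms(2) inverse_nonzero_iff_nonzero scaleR_left_commute scale_one right_inverse scaleR_scaleR surj_def)
qed

lemma AE_lborel_mult:
  fixes P :: "real \<Rightarrow> bool"
  shows "AE a in lborel. P a \<Longrightarrow> t \<noteq> 0 \<Longrightarrow> AE a in lborel. P (t * a)"
  using AE_lborel_scaleR[of P t] unfolding real_scaleR_def .

text \<open>Exchanges the \<open>i\<close>-th coordinate with a spare real variable. As a linear
  involution it preserves null sets, which reduces statements about \<open>upd\<close> to Fubini on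
  a product.\<close>

definition coordinate_swap :: "'d::finite \<Rightarrow> (real ^ 'd) \<times> real \<Rightarrow> (real ^ 'd) \<times> real"
  where "coordinate_swap i = (\<lambda>(x, a). (upd x i a, x $ i))"

lemma coordinate_swap_involutive: "coordinate_swap i (coordinate_swap i z) = z"
  by (auto simp: coordinate_swap_def vec_eq_iff split: prod.split)

lemma linear_coordinate_swap: "linear (coordinate_swap i)"
  by (rule linearI) (auto simp: coordinate_swap_def vec_eq_iff split: prod.split)

lemma AE_coordinate_swap:
  assumes "AE z in lborel. P z"
  shows "AE z in lborel. P (coordinate_swap i z)"
proof (rule AE_lborel_linear_image)
  show "AE z in lborel. P (coordinate_swap i (coordinate_swap i z))"
    using assms by (simp add: coordinate_swap_involutive)
  show "linear (coordinate_swap i)" by (rule linear_coordinate_swap)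
  show "surj (coordinate_swap i)" by (metis coordinate_swap_involutive surj_def)
qed

lemma AE_lborel_fst:
  fixes Q :: "'a::euclidean_space \<Rightarrow> bool"
  assumes "AE x in lborel. Q x"
  shows "AE z in lborel. Q (fst (z :: 'a \<times> 'b::euclidean_space))"
proof -
  obtain N where N: "N \<in> null_sets lborel" "{x. \<not> Q x} \<subseteq> N"
    using assms unfolding eventually_ae_filter by auto
  have "N \<times> (UNIV :: 'b set) \<in> null_sets (lborel \<Otimes>\<^sub>M lborel)"
    by (intro lborel.times_in_null_sets1 N(1)) simp
  then show ?thesis
    unfolding lborel_prod using N(2) by (intro AE_I'[where N = "N \<times> UNIV"]) auto
qed

lemma AE_lborel_snd:
  fixes Q :: "'b::euclidean_space \<Rightarrow> bool"
  assumes "AE x in lborel. Q x"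
  shows "AE z in lborel. Q (snd (z :: 'a::euclidean_space \<times> 'b))"
proof -
  obtain N where N: "N \<in> null_sets lborel" "{x. \<not> Q x} \<subseteq> N"
    using assms unfolding eventually_ae_filter by auto
  have "(UNIV :: 'a set) \<times> N \<in> null_sets (lborel \<Otimes>\<^sub>M lborel)"
    by (intro lborel.times_in_null_sets2 N(1)) simp
  then show ?thesis
    unfolding lborel_prod using N(2) by (intro AE_I'[where N = "UNIV \<times> N"]) auto
qed

lemma AE_lborel_pairD:
  fixes P :: "'a::euclidean_space \<Rightarrow> 'b::euclidean_space \<Rightarrow> bool"
  assumes "AE z in lborel. P (fst z) (snd z)"
  shows "AE x in lborel. AE y in lborel. P x y"
  using lborel_pair.AE_pair[of "\<lambda>z. P (fst z) (snd z)"] assms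
  unfolding lborel_prod fst_conv snd_conv by blast

text \<open>A spare variable is added, swapped with the \<open>i\<close>-th coordinate, and
  separated again by Fubini. This is how one coordinate is freed while the others stay
  generic.\<close>

lemma AE_upd:
  fixes Q :: "real ^ 'd \<Rightarrow> bool"
  assumes "AE x in lborel. Q x"
  shows "AE x in lborel. AE a in lborel. Q (upd x i a)"
  using AE_coordinate_swap[OF AE_lborel_fst[OF assms, where 'b = real], of i]
  by (intro AE_lborel_pairD) (simp add: coordinate_swap_def case_prod_unfold)

lemma AE_coordinate:
  fixes P :: "real \<Rightarrow> bool"
  assumes "AE a in lborel. P a"
  shows "AE x in lborel. P ((x :: real ^ 'd) $ i)"
proof -
  have "AE x::real ^ 'd in lborel. AE a::real in lborel. P (x $ i)"
    using AE_coordinate_swap[OF AE_lborel_snd[OF assms, where 'a = "real ^ 'd"], of i]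
    by (intro AE_lborel_pairD) (simp add: coordinate_swap_def case_prod_unfold)
  \<comment> \<open>The inner statement does not involve \<open>a\<close>, and the real line is not
    a null set, so it holds outright.\<close>
  then show ?thesis
    by (rule AE_mp) (intro AE_I2 impI, simp add: AE_lborel_iff_negligible split: if_splits)
qed

lemma AE_all_coordinates:
  fixes P :: "'d::finite \<Rightarrow> real \<Rightarrow> bool"
  assumes "\<And>i. AE a in lborel. P i a"
  shows "AE x in lborel. \<forall>i. P i ((x :: real ^ 'd) $ i)"
  using AE_coordinate[OF assms] by (intro AE_all_countable[THEN iffD2] allI)

lemma AE_nonzero_coordinates: "AE x in lborel. \<forall>i::'d::finite. (x :: real ^ 'd) $ i \<noteq> 0"
proof (rule AE_all_coordinates)
  show "AE a::real in lborel. a \<noteq> 0" for i :: 'd using AE_lborel_singleton[of 0] by simp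
qed

lemma AE_imp_ex_in_open:
  fixes P :: "'a::euclidean_space \<Rightarrow> bool"
  assumes "AE x in lborel. P x" "open U" "U \<noteq> {}"
  shows "\<exists>x\<in>U. P x"
proof (rule ccontr)
  assume "\<not> ?thesis"
  then have "negligible U"
    using assms(1) unfolding AE_lborel_iff_negligible by (auto intro: negligible_subset)
  then show False using assms(2,3) open_not_negligible by blast
qed

lemma AE_real_imp_ex:
  fixes P :: "real \<Rightarrow> bool"
  assumes "AE a in lborel. 0 < a \<longrightarrow> P a"
  shows "\<exists>a>0. P a"
  using AE_imp_ex_in_open[OF assms, of "{0<..}"] by auto

subsection \<open>A Cauchy functional equation up to null sets\<close>

text \<open>Subtracting the linear function that agrees with \<open>k\<close> at \<open>L\<close>
  leaves an additive \<delta> vanishing at \<open>L\<close>. It is \<open>L\<close>-periodic, hence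
  bounded on the half-line, hence zero, since multiples of a nonzero value would be
  unbounded.\<close>

lemma bounded_additive_linear:
  fixes k :: "real \<Rightarrow> real"
  assumes add: "\<And>x y. 0 \<le> x \<Longrightarrow> 0 \<le> y \<Longrightarrow> k (x + y) = k x + k y"
    and L: "0 < L" and bound: "\<And>x. 0 \<le> x \<Longrightarrow> x \<le> L \<Longrightarrow> \<bar>k x\<bar> \<le> B"
    and "0 \<le> x"
  shows "k x = k L / L * x"
proof -
  define \<delta> where "\<delta> x = k x - k L / L * x" for x
  have \<delta>_add: "\<delta> (x + y) = \<delta> x + \<delta> y" if "0 \<le> x" "0 \<le> y" for x y
    using add[OF that] by (simp add: \<delta>_def algebra_simps add_divide_distrib)
  have mult: "\<delta> (real n * x) = real n * \<delta> x" if "0 \<le> x" for n x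
  proof (induction n)
    case 0
    show ?case using \<delta>_add[of 0 0] by simp
  next
    case (Suc n)
    then show ?case using \<delta>_add[of "real n * x" x] that by (simp add: algebra_simps)
  qed
  have \<delta>L: "\<delta> L = 0" using L by (simp add: \<delta>_def)
  have bd: "\<bar>\<delta> x\<bar> \<le> B + \<bar>k L\<bar>" if "0 \<le> x" for x
  proof -
    define n where "n = nat \<lfloor>x / L\<rfloor>"
    define r where "r = x - real n * L"
    have "real n = of_int \<lfloor>x / L\<rfloor>" using that L by (simp add: n_def)
    then have "real n \<le> x / L" "x / L < real n + 1" by linarith+
    then have r: "0 \<le> r" "r \<le> L" using L by (simp_all add: r_def field_simps)
    have "\<delta> x = \<delta> (real n * L + r)" by (simp add: r_def)
    also have "\<dots> = \<delta> r" using \<delta>_add[of "real n * L" r] mult[of L n] r L \<delta>L by simp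
    finally have "\<delta> x = k r - k L / L * r" by (simp add: \<delta>_def)
    then have "\<bar>\<delta> x\<bar> \<le> \<bar>k r\<bar> + \<bar>k L / L * r\<bar>" by linarith
    moreover have "\<bar>k L / L * r\<bar> \<le> \<bar>k L\<bar>"
      using r L by (simp add: abs_mult field_simps mult_right_mono)
    ultimately show ?thesis using bound[OF r] by linarith
  qed
  have "\<delta> x = 0"
  proof (rule ccontr)
    assume ne: "\<delta> x \<noteq> 0"
    obtain n where "B + \<bar>k L\<bar> < real n * \<bar>\<delta> x\<bar>"
      using ne reals_Archimedean3[of "\<bar>\<delta> x\<bar>"] by auto
    then show False using bd[of "real n * x"] mult[of x n] \<open>0 \<le> x\<close> by (simp add: abs_mult)
  qed
  then show ?thesis by (simp add: \<delta>_def)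
qed

text \<open>The set where \<open>\<bar>T\<bar> \<le> n\<close> fills almost all of \<open>{0<..1}\<close>, hence it meets its own dilation.\<close>

lemma dilation_increment_bounded:
  fixes T \<kappa> :: "real \<Rightarrow> real"
  assumes [measurable]: "T \<in> borel_measurable borel"
    and \<kappa>: "\<And>t. 1 \<le> t \<Longrightarrow> AE a in lborel. 0 < a \<longrightarrow> T (t * a) = T a + \<kappa> t"
  shows "\<exists>B. \<forall>t. 1 \<le> t \<and> t \<le> 2 \<longrightarrow> \<bar>\<kappa> t\<bar> \<le> B"
proof -
  define A where "A n = {a. 0 < a \<and> a \<le> 1 \<and> \<bar>T a\<bar> \<le> real n}" for n
  have [measurable]: "A n \<in> sets borel" for n unfolding A_def by measurable
  have sub: "A n \<subseteq> {0..1}" for n by (auto simp: A_def)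
  have unit: "{0..1::real} \<in> fmeasurable lborel" by (rule fmeasurableI) auto
  have fin: "A n \<in> fmeasurable lborel" for n
    by (rule fmeasurableI2[OF unit sub]) simp
  have "(\<Union>n. A n) = {0<..1}"
    using real_arch_simple by (fastforce simp: A_def)
  moreover have "(\<lambda>n. measure lborel (A n)) \<longlonglongrightarrow> measure lborel (\<Union>n. A n)"
    by (rule Lim_measure_incseq) (auto simp: incseq_def A_def \<open>(\<Union>n. A n) = {0<..1}\<close>[unfolded A_def])
  ultimately have "(\<lambda>n. measure lborel (A n)) \<longlonglongrightarrow> 1" by simp
  \<comment> \<open>Any threshold above 2/3 would serve: the set \<open>D\<close> below has at least
    half the measure of \<open>A n\<close>, and two almost disjoint subsets of \<open>{0..1}\<close>
    have total measure at most 1.\<close>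
  then have "\<forall>\<^sub>F n in sequentially. 7/8 < measure lborel (A n)"
    by (rule order_tendstoD) simp
  then obtain n where n: "7/8 < measure lborel (A n)"
    by (auto simp: eventually_sequentially)
  have "\<bar>\<kappa> t\<bar> \<le> 2 * real n" if t: "1 \<le> t" "t \<le> 2" for t
  proof (rule ccontr)
    assume "\<not> ?thesis"
    define D where "D = {a. t * a \<in> A n}"
    have [measurable]: "D \<in> sets borel" unfolding D_def by measurable
    have "D \<subseteq> {0..1}"
    proof
      fix a assume "a \<in> D"
      then have a: "0 < t * a" "t * a \<le> 1" by (auto simp: D_def A_def)
      then have "0 < a" using t by (simp add: zero_less_mult_iff)
      moreover have "1 * a \<le> t * a" using t \<open>0 < a\<close> by (intro mult_right_mono) auto
      then have "a \<le> 1" using a by linarith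
      ultimately show "a \<in> {0..1}" using a by simp
    qed
    then have Dfin: "D \<in> fmeasurable lborel"
      by (intro fmeasurableI2[OF unit]) auto
    have "emeasure lborel (A n) = t * emeasure lborel D"
    proof -
      have "emeasure lborel (A n) = (\<integral>\<^sup>+x. indicator (A n) x \<partial>lborel)" by simp
      also have "\<dots> = \<bar>t\<bar> * (\<integral>\<^sup>+x. indicator (A n) (0 + t * x) \<partial>lborel)"
        using t by (intro nn_integral_real_affine) auto
      also have "(\<integral>\<^sup>+x. indicator (A n) (0 + t * x) \<partial>lborel) = (\<integral>\<^sup>+x. indicator D x \<partial>lborel)"
        by (intro nn_integral_cong) (simp add: D_def indicator_def)
      finally show ?thesis using t by simp
    qed
    then have mD: "measure lborel (A n) = t * measure lborel D"
      using t by (simp add: measure_def enn2real_mult)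
    have "AE a in lborel. a \<notin> A n \<or> a \<notin> D"
      using \<kappa>[OF t(1)]
    proof eventually_elim
      case (elim a)
      then show ?case using \<open>\<not> \<bar>\<kappa> t\<bar> \<le> 2 * real n\<close> by (auto simp: A_def D_def)
    qed
    then have "measure lborel (A n \<union> D) = measure lborel (A n) + measure lborel D"
      using fin Dfin by (rule measure_Un_AE)
    moreover have "measure lborel (A n \<union> D) \<le> measure lborel {0..1::real}"
      using sub[of n] \<open>D \<subseteq> {0..1}\<close> by (intro measure_mono_fmeasurable unit) auto
    moreover have "measure lborel (A n) \<le> 2 * measure lborel D"
      unfolding mD using t by (intro mult_right_mono) auto
    ultimately show False using n by simp
  qed
  then show ?thesis by blast
qed

text \<open>By Fubini a single \<open>a\<close> satisfies \<open>G (t * a) = G a\<close> for almost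
  every \<open>t\<close>, and \<open>t * a\<close> then runs through almost all of the
  half-line.\<close>

lemma dilation_invariant_imp_AE_const:
  fixes G :: "real \<Rightarrow> real"
  assumes [measurable]: "G \<in> borel_measurable borel"
    and inv: "\<And>t. 0 < t \<Longrightarrow> AE a in lborel. 0 < a \<longrightarrow> G (t * a) = G a"
  shows "\<exists>c. AE a in lborel. 0 < a \<longrightarrow> G a = c"
proof -
  have "AE t in lborel. AE a in lborel. 0 < t \<longrightarrow> 0 < a \<longrightarrow> G (t * a) = G a"
    
  proof (rule AE_I2)
    show "AE a in lborel. 0 < t \<longrightarrow> 0 < a \<longrightarrow> G (t * a) = G a" for t :: real
      using inv[of t] by (cases "0 < t") auto
  qed
  then have "AE a in lborel. AE t in lborel. 0 < t \<longrightarrow> 0 < a \<longrightarrow> G (t * a) = G a"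
    by (rule lborel_pair.AE_commute[THEN iffD1, rotated]) measurable
  from AE_imp_ex_in_open[OF this, of "{0<..}"] obtain a
    where a: "0 < a" and "AE t in lborel. 0 < t \<longrightarrow> 0 < a \<longrightarrow> G (t * a) = G a"
    by auto
  from AE_lborel_mult[OF this(2), of "inverse a"] a
  have "AE t in lborel. 0 < t \<longrightarrow> G t = G a" by (simp add: zero_less_mult_iff field_simps)
  then show ?thesis by blast
qed

text \<open>The increment \<kappa> is additive in \<open>ln t\<close> and bounded for
  \<open>t\<close> between 1 and 2, hence a multiple of the logarithm. Subtracting that multiple
  from \<open>T\<close> leaves a dilation-invariant function.\<close>

lemma log_affine_if_dilation_increment:
  fixes T :: "real \<Rightarrow> real"
  assumes [measurable]: "T \<in> borel_measurable borel"
    and "\<And>t. 1 \<le> t \<Longrightarrow> \<exists>\<kappa>. AE a in lborel. 0 < a \<longrightarrow> T (t * a) = T a + \<kappa>"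
  shows "\<exists>\<alpha> \<beta>. AE a in lborel. 0 < a \<longrightarrow> T a = \<alpha> * ln a + \<beta>"
proof -
  obtain \<kappa> where \<kappa>: "\<And>t. 1 \<le> t \<Longrightarrow> AE a in lborel. 0 < a \<longrightarrow> T (t * a) = T a + \<kappa> t"
    using assms(2) by metis
  obtain B where B: "\<And>t. 1 \<le> t \<Longrightarrow> t \<le> 2 \<Longrightarrow> \<bar>\<kappa> t\<bar> \<le> B"
    using dilation_increment_bounded[OF assms(1) \<kappa>] by blast
  have mult: "\<kappa> (s * t) = \<kappa> s + \<kappa> t" if st: "1 \<le> s" "1 \<le> t" for s t
  proof -
    have "1 \<le> s * t" using st by (metis mult_mono' mult_1 zero_le_one order_trans)
    have "AE a in lborel. 0 < t * a \<longrightarrow> T (s * (t * a)) = T (t * a) + \<kappa> s"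
      using AE_lborel_mult[OF \<kappa>[OF st(1)], of t] st by simp
    with \<kappa>[OF \<open>1 \<le> s * t\<close>] \<kappa>[OF st(2)]
    have "AE a::real in lborel. 0 < a \<longrightarrow> \<kappa> (s * t) = \<kappa> s + \<kappa> t"
    proof eventually_elim
      case (elim a)
      then show ?case using st by (auto simp: mult.assoc)
    qed
    from AE_real_imp_ex[OF this] show ?thesis by blast
  qed
  \<comment> \<open>The slope is read off at \<open>ln 2\<close>, the right end of the interval on
    which \<kappa> is bounded in the variable \<open>ln t\<close>.\<close>
  define \<alpha> where "\<alpha> = \<kappa> (exp (ln 2)) / ln 2"
  have \<kappa>_ln: "\<kappa> t = \<alpha> * ln t" if "1 \<le> t" for t
  proof -
    have "\<kappa> (exp (ln t)) = \<kappa> (exp (ln 2)) / ln 2 * ln t"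
    proof (rule bounded_additive_linear[where B = B])
      show "\<kappa> (exp (x + y)) = \<kappa> (exp x) + \<kappa> (exp y)" if "0 \<le> x" "0 \<le> y" for x y
        using mult[of "exp x" "exp y"] that by (simp add: exp_add)
      show "\<bar>\<kappa> (exp x)\<bar> \<le> B" if "0 \<le> x" "x \<le> ln 2" for x
        using that by (intro B) (auto simp: ln_ge_iff)
    qed (use that in auto)
    then show ?thesis using that by (simp add: \<alpha>_def)
  qed
  define G where "G a = T a - \<alpha> * ln a" for a
  have [measurable]: "G \<in> borel_measurable borel" unfolding G_def by measurable
  have G1: "AE a in lborel. 0 < a \<longrightarrow> G (t * a) = G a" if "1 \<le> t" for t
    using \<kappa>[OF that]
  proof eventually_elim
    case (elim a)
    then show ?case using that by (auto simp: G_def \<kappa>_ln ln_mult algebra_simps)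
  qed
  have "AE a in lborel. 0 < a \<longrightarrow> G (t * a) = G a" if "0 < t" for t
  proof (cases "1 \<le> t")
    case False
    then have "AE a in lborel. 0 < a \<longrightarrow> G (inverse t * a) = G a"
      using that by (intro G1) (simp add: one_le_inverse)
    from AE_lborel_mult[OF this, of t] show ?thesis
      by (rule AE_mp) (use that in \<open>auto simp: mult.assoc[symmetric]\<close>)
  qed (use G1 in auto)
  then obtain c where "AE a in lborel. 0 < a \<longrightarrow> G a = c"
    using dilation_invariant_imp_AE_const[of G] by auto
  then have "AE a in lborel. 0 < a \<longrightarrow> T a = \<alpha> * ln a + c"
    by (rule AE_mp) (auto simp: G_def)
  then show ?thesis by blast
qed

subsection \<open>Pairwise energies that are homogeneous up to a logarithm\<close>

definition quad :: "real ^ 'd ^ 'd \<Rightarrow> ('d \<Rightarrow> real) \<Rightarrow> real"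
  where "quad \<Theta> z = (\<Sum>i\<in>UNIV. \<Sum>j\<in>UNIV. \<Theta> $ i $ j * z i * z j)"

text \<open>The vector parameters affect the density only through the scalar functions
  \<open>\<mu> $ i \<bullet> S i a\<close> of \<open>a\<close>, for which \<open>s i\<close>
  stands.\<close>

definition energy ::
  "('d::finite \<Rightarrow> real \<Rightarrow> real) \<Rightarrow> real ^ 'd ^ 'd \<Rightarrow> ('d \<Rightarrow> real \<Rightarrow> real) \<Rightarrow> real ^ 'd \<Rightarrow> real"
  where "energy s \<Theta> T y = (\<Sum>i\<in>UNIV. s i (y $ i)) + quad \<Theta> (\<lambda>i. T i (y $ i))"

text \<open>Homogeneity of order -(d+1) after taking negative logarithms, on the points of the
  support with positive coordinates. The exceptional null set may depend on
  \<open>t\<close>.\<close>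

definition log_homogeneous :: "(real ^ 'd \<Rightarrow> real) \<Rightarrow> bool"
  where "log_homogeneous H \<longleftrightarrow> (\<forall>t\<ge>1. AE y in lborel. (\<forall>k. 0 < y $ k) \<longrightarrow> (\<exists>k. 1 < y $ k) \<longrightarrow>
    H (t *\<^sub>R y) = H y + (real CARD('d) + 1) * ln t)"

definition AE_const :: "(real \<Rightarrow> real) \<Rightarrow> bool"
  where "AE_const T \<longleftrightarrow> (\<exists>c. AE a in lborel. 0 < a \<longrightarrow> T a = c)"

text \<open>Row \<open>i\<close> and column \<open>i\<close> contribute equally by symmetry, hence
  the factor 2 in the linear coefficient.\<close>

lemma quad_upd:
  fixes \<Theta> :: "real ^ 'd ^ 'd"
  assumes "transpose \<Theta> = \<Theta>"
  shows "quad \<Theta> (z(i := a)) = \<Theta> $ i $ i * a\<^sup>2 + 2 * a * (\<Sum>l\<in>-{i}. \<Theta> $ i $ l * z l) +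
    (\<Sum>k\<in>-{i}. \<Sum>l\<in>-{i}. \<Theta> $ k $ l * z k * z l)"
proof -
  have sym: "\<Theta> $ k $ l = \<Theta> $ l $ k" for k l
    using assms by (metis transpose_def vec_lambda_beta)
  have split: "(\<Sum>k\<in>UNIV. f k) = f i + (\<Sum>k\<in>-{i}. f k)" for f :: "'d \<Rightarrow> real"
    by (simp add: sum.remove[of UNIV i f] Compl_eq_Diff_UNIV)
  have "(\<Sum>k\<in>-{i}. \<Sum>l\<in>UNIV. \<Theta> $ k $ l * (z(i := a)) k * (z(i := a)) l) =
    (\<Sum>k\<in>-{i}. a * (\<Theta> $ i $ k * z k) + (\<Sum>l\<in>-{i}. \<Theta> $ k $ l * z k * z l))"
    by (rule sum.cong) (auto simp: split sym[of _ i] intro!: sum.cong)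
  then show ?thesis
    unfolding quad_def
    by (subst split, subst split)
      (simp add: sum.distrib sum_distrib_left[symmetric] power2_eq_square algebra_simps)
qed

lemma quad_second_difference:
  fixes \<Theta> :: "real ^ 'd ^ 'd"
  assumes "transpose \<Theta> = \<Theta>" "i \<noteq> j"
  shows "quad \<Theta> (z(i := a', j := b')) - quad \<Theta> (z(i := a', j := b)) -
      quad \<Theta> (z(i := a, j := b')) + quad \<Theta> (z(i := a, j := b)) =
    2 * \<Theta> $ i $ j * (a' - a) * (b' - b)"
proof -
  have sym: "\<Theta> $ i $ j = \<Theta> $ j $ i"
    using assms by (metis transpose_def vec_lambda_beta)
  have "(\<Sum>l\<in>-{j}. \<Theta> $ j $ l * (z(i := c)) l) =
      \<Theta> $ i $ j * c + (\<Sum>l\<in>-{j}-{i}. \<Theta> $ j $ l * z l)" for c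
    using assms(2) by (subst sum.remove[of _ i]) (auto simp: sym)
  then show ?thesis
    unfolding quad_upd[OF assms(1), of _ j] by (simp add: algebra_simps)
qed

lemma scaleR_upd: "t *\<^sub>R upd y i a = upd (t *\<^sub>R y) i (t * a)"
  by (simp add: vec_eq_iff)

lemma energy_upd2:
  assumes "i \<noteq> j"
  shows "energy s \<Theta> T (upd (upd y i a) j b) =
    (\<Sum>k\<in>-{i, j}. s k (y $ k)) + s i a + s j b +
      quad \<Theta> ((\<lambda>k. T k (y $ k))(i := T i a, j := T j b))"
proof -
  have "(\<lambda>k. T k (upd (upd y i a) j b $ k)) = (\<lambda>k. T k (y $ k))(i := T i a, j := T j b)"
    using assms by auto
  moreover have "(\<Sum>k\<in>UNIV. s k (upd (upd y i a) j b $ k)) =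
      s i a + (s j b + (\<Sum>k\<in>-{i, j}. s k (y $ k)))"
    using assms by (subst sum.remove[of _ i], simp, simp, subst sum.remove[of _ j])
      (auto intro!: sum.cong)
  ultimately show ?thesis by (simp add: energy_def)
qed

text \<open>Every term that misses one of the two coordinates cancels, in particular all main
  effects, so the interaction of \<open>i\<close> and \<open>j\<close> is isolated.\<close>

lemma energy_second_difference:
  assumes "transpose \<Theta> = \<Theta>" "i \<noteq> j"
  shows "energy s \<Theta> T (upd (upd y i a') j b') - energy s \<Theta> T (upd (upd y i a') j b) -
      energy s \<Theta> T (upd (upd y i a) j b') + energy s \<Theta> T (upd (upd y i a) j b) =
    2 * \<Theta> $ i $ j * (T i a' - T i a) * (T j b' - T j b)"
  using quad_second_difference[OF assms, of "\<lambda>k. T k (y $ k)" "T i a'" "T j b'" "T j b" "T i a"]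
  unfolding energy_upd2[OF assms(2)] by linarith

section \<open>Sections of the homogeneity relation in one or two coordinates\<close>

lemma ex_other: "\<exists>k. k \<notin> I" if "card I < CARD('d)" for I :: "'d::finite set"
  using that by (metis UNIV_eq_I less_irrefl)

lemma ex_of_AE_above_one:
  fixes Q :: "real ^ 'd \<Rightarrow> bool"
  assumes "AE y in lborel. Q y"
  shows "\<exists>y. (\<forall>k. 1 < y $ k) \<and> Q y"
proof -
  have "open {y :: real ^ 'd. \<forall>k. 1 < y $ k}"
    by (simp add: Collect_all_eq open_INT open_Collect_less continuous_on_component)
  moreover have "(\<chi> k. 2) \<in> {y :: real ^ 'd. \<forall>k. 1 < y $ k}" by simp
  ultimately show ?thesis using AE_imp_ex_in_open[OF assms] by blast
qed

text \<open>A coordinate other than \<open>i\<close> stays above 1, so the \<open>i\<close>-th one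
  may run over the whole positive half-line without leaving the support.\<close>

lemma log_homogeneous_section:
  fixes H :: "real ^ 'd \<Rightarrow> real"
  assumes "log_homogeneous H" "CARD('d) \<ge> 2" "1 \<le> t"
  shows "\<exists>y. (\<forall>k. 1 < y $ k) \<and> (AE a in lborel. 0 < a \<longrightarrow>
    H (t *\<^sub>R upd y i a) = H (upd y i a) + (real CARD('d) + 1) * ln t)"
proof -
  obtain k where k: "k \<noteq> i" using ex_other[of "{i}"] assms(2) by auto
  have "AE y in lborel. (\<forall>k. 0 < y $ k) \<longrightarrow> (\<exists>k. 1 < y $ k) \<longrightarrow>
      H (t *\<^sub>R y) = H y + (real CARD('d) + 1) * ln t"
    using assms by (simp add: log_homogeneous_def)
  from ex_of_AE_above_one[OF AE_upd[OF this, of i]] obtain y :: "real ^ 'd" where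
    y: "\<forall>k. 1 < y $ k" and ae: "AE a in lborel. (\<forall>k. 0 < upd y i a $ k) \<longrightarrow>
      (\<exists>k. 1 < upd y i a $ k) \<longrightarrow> H (t *\<^sub>R upd y i a) = H (upd y i a) + (real CARD('d) + 1) * ln t"
    by blast
  have pos: "\<forall>k. 0 < y $ k" using y by (meson less_trans zero_less_one)
  have "AE a in lborel. 0 < a \<longrightarrow>
    H (t *\<^sub>R upd y i a) = H (upd y i a) + (real CARD('d) + 1) * ln t"
    using ae
  proof eventually_elim
    case (elim a)
    moreover have "0 < a \<Longrightarrow> \<forall>k. 0 < upd y i a $ k" using pos by simp
    moreover have "\<exists>k. 1 < upd y i a $ k" using y k by (intro exI[of _ k]) simp
    ultimately show ?case by blast
  qed
  with y show ?thesis by blast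
qed

text \<open>With two coordinates running freely towards 0, a third one above 1 is what keeps the
  point in the support; hence dimension at least 3.\<close>

lemma log_homogeneous_section2:
  fixes H :: "real ^ 'd \<Rightarrow> real"
  assumes "log_homogeneous H" "CARD('d) \<ge> 3" "1 \<le> t"
  shows "\<exists>y. AE a in lborel. AE b in lborel. 0 < a \<longrightarrow> 0 < b \<longrightarrow>
    H (t *\<^sub>R upd (upd y i a) j b) = H (upd (upd y i a) j b) + (real CARD('d) + 1) * ln t"
proof -
  have "card {i, j} \<le> 2" by (simp add: card_insert_if)
  then obtain k where k: "k \<noteq> i" "k \<noteq> j" using ex_other[of "{i, j}"] assms(2) by auto
  have "AE y in lborel. (\<forall>k. 0 < y $ k) \<longrightarrow> (\<exists>k. 1 < y $ k) \<longrightarrow>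
      H (t *\<^sub>R y) = H y + (real CARD('d) + 1) * ln t"
    using assms by (simp add: log_homogeneous_def)
  from ex_of_AE_above_one[OF AE_upd[OF AE_upd[OF this, of j], of i]] obtain y :: "real ^ 'd" where
    y: "\<forall>k. 1 < y $ k" and ae: "AE a in lborel. AE b in lborel.
      (\<forall>k. 0 < upd (upd y i a) j b $ k) \<longrightarrow> (\<exists>k. 1 < upd (upd y i a) j b $ k) \<longrightarrow>
      H (t *\<^sub>R upd (upd y i a) j b) = H (upd (upd y i a) j b) + (real CARD('d) + 1) * ln t"
    by blast
  have pos: "\<forall>k. 0 < y $ k" using y by (meson less_trans zero_less_one)
  have "AE a in lborel. AE b in lborel. 0 < a \<longrightarrow> 0 < b \<longrightarrow>
    H (t *\<^sub>R upd (upd y i a) j b) = H (upd (upd y i a) j b) + (real CARD('d) + 1) * ln t"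
    using ae
  proof eventually_elim
    case (elim a)
    then show ?case
    proof eventually_elim
      case (elim b)
      moreover have "0 < a \<Longrightarrow> 0 < b \<Longrightarrow> \<forall>k. 0 < upd (upd y i a) j b $ k" using pos by simp
      moreover have "\<exists>k. 1 < upd (upd y i a) j b $ k" using y k by (intro exI[of _ k]) simp
      ultimately show ?case by blast
    qed
  qed
  then show ?thesis by blast
qed

lemma log_homogeneous_cong:
  assumes "log_homogeneous H" and eq: "AE y in lborel. (\<forall>k. 0 < y $ k) \<longrightarrow> H y = H' y"
  shows "log_homogeneous H'"
  unfolding log_homogeneous_def
proof (intro allI impI)
  fix t :: real assume t: "1 \<le> t"
  have "AE y in lborel. (\<forall>k. 0 < y $ k) \<longrightarrow> (\<exists>k. 1 < y $ k) \<longrightarrow>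
      H (t *\<^sub>R y) = H y + (real CARD('a) + 1) * ln t"
    using assms(1) t by (simp add: log_homogeneous_def)
  moreover have "AE y in lborel. (\<forall>k. 0 < (t *\<^sub>R y) $ k) \<longrightarrow> H (t *\<^sub>R y) = H' (t *\<^sub>R y)"
    using t by (intro AE_lborel_scaleR[OF eq]) simp
  ultimately show "AE y in lborel. (\<forall>k. 0 < y $ k) \<longrightarrow> (\<exists>k. 1 < y $ k) \<longrightarrow>
      H' (t *\<^sub>R y) = H' y + (real CARD('a) + 1) * ln t"
    using eq
  proof eventually_elim
    case (elim y)
    then show ?case using t by auto
  qed
qed

lemma energy_cong_AE:
  assumes "\<And>i. AE a in lborel. 0 < a \<longrightarrow> s i a = s' i a" "\<And>i. AE a in lborel. 0 < a \<longrightarrow> T i a = T' i a"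
  shows "AE y in lborel. (\<forall>k. 0 < y $ k) \<longrightarrow> energy s \<Theta> T y = energy s' \<Theta> T' y"
  using AE_all_coordinates[where P = "\<lambda>i a. 0 < a \<longrightarrow> s i a = s' i a", OF assms(1)]
    AE_all_coordinates[where P = "\<lambda>i a. 0 < a \<longrightarrow> T i a = T' i a", OF assms(2)]
  by eventually_elim (simp add: energy_def)

text \<open>Homogeneity makes the increment of \<open>H\<close> independent of \<open>a\<close>. If
  \<open>h\<close> carries the whole dependence of that increment on \<open>a\<close>, the dilation
  increments of \<open>h\<close> are constant too.\<close>

lemma log_affine_summand:
  fixes H :: "real ^ 'd \<Rightarrow> real"
  assumes "log_homogeneous H" "CARD('d) \<ge> 2" "h \<in> borel_measurable borel"
    and "\<And>t y. 1 \<le> t \<Longrightarrow> (\<forall>k. 0 < y $ k) \<Longrightarrow>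
      \<exists>\<kappa>. \<forall>a>0. H (t *\<^sub>R upd y i a) - H (upd y i a) = h (t * a) - h a + \<kappa>"
  shows "\<exists>\<nu> \<gamma>. AE a in lborel. 0 < a \<longrightarrow> h a = \<nu> * ln a + \<gamma>"
proof (rule log_affine_if_dilation_increment[OF assms(3)])
  fix t :: real assume t: "1 \<le> t"
  obtain y where y: "\<forall>k. 1 < y $ k" and ae: "AE a in lborel. 0 < a \<longrightarrow>
      H (t *\<^sub>R upd y i a) = H (upd y i a) + (real CARD('d) + 1) * ln t"
    using log_homogeneous_section[OF assms(1,2) t] by blast
  have "\<forall>k. 0 < y $ k" using y by (meson less_trans zero_less_one)
  then obtain \<kappa> where "\<forall>a>0. H (t *\<^sub>R upd y i a) - H (upd y i a) = h (t * a) - h a + \<kappa>"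
    using assms(4)[OF t] by blast
  then have "AE a in lborel. 0 < a \<longrightarrow> h (t * a) = h a + ((real CARD('d) + 1) * ln t - \<kappa>)"
    using ae
  proof eventually_elim
    case (elim a)
    then show ?case
      using \<open>\<forall>a>0. H (t *\<^sub>R upd y i a) - H (upd y i a) = h (t * a) - h a + \<kappa>\<close> by fastforce
  qed
  then show "\<exists>\<kappa>. AE a in lborel. 0 < a \<longrightarrow> h (t * a) = h a + \<kappa>" by blast
qed

subsection \<open>The pair statistics are logarithms\<close>

lemma not_AE_const_differ:
  assumes "\<not> AE_const v" "AE a in lborel. 0 < a \<longrightarrow> a \<in> A"
  shows "\<exists>a\<in>A. \<exists>a'\<in>A. v a \<noteq> v a'"
proof (rule ccontr)
  assume *: "\<not> ?thesis"
  obtain a where a: "a \<in> A" using AE_real_imp_ex[OF assms(2)] by blast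
  have "AE b in lborel. 0 < b \<longrightarrow> v b = v a"
    using assms(2)
  proof eventually_elim
    case (elim b)
    then show ?case using a * by blast
  qed
  then show False using assms(1) by (auto simp: AE_const_def)
qed

text \<open>Fixing one increment of \<open>u2\<close> that is nonzero makes the increments of
  \<open>v1\<close> proportional to those of \<open>v2\<close>; inserting this back makes
  \<open>u1\<close> proportional to \<open>u2\<close> with the inverse ratio. The set
  \<open>B\<close> may depend on the pair \<open>a\<close>, \<open>a'\<close> because null sets
  do.\<close>

lemma separate_increments:
  fixes u1 u2 v1 v2 :: "real \<Rightarrow> real"
  assumes A: "AE a in lborel. 0 < a \<longrightarrow> a \<in> A"
    and B: "\<And>a a'. a \<in> A \<Longrightarrow> a' \<in> A \<Longrightarrow> \<exists>B. (AE b in lborel. 0 < b \<longrightarrow> b \<in> B) \<and>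
      (\<forall>b\<in>B. \<forall>b'\<in>B. (u1 a' - u1 a) * (v1 b' - v1 b) = (u2 a' - u2 a) * (v2 b' - v2 b))"
    and nc: "\<not> AE_const u2" "\<not> AE_const v2"
  shows "\<exists>r \<kappa> \<kappa>'. r \<noteq> 0 \<and> (AE a in lborel. 0 < a \<longrightarrow> u1 a = r * u2 a + \<kappa>) \<and>
    (AE b in lborel. 0 < b \<longrightarrow> v1 b = inverse r * v2 b + \<kappa>')"
proof -
  obtain a0 a1 where a: "a0 \<in> A" "a1 \<in> A" "u2 a0 \<noteq> u2 a1"
    using not_AE_const_differ[OF nc(1) A] by blast
  obtain B where B1: "AE b in lborel. 0 < b \<longrightarrow> b \<in> B"
    and B2: "\<And>b b'. b \<in> B \<Longrightarrow> b' \<in> B \<Longrightarrow>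
      (u1 a1 - u1 a0) * (v1 b' - v1 b) = (u2 a1 - u2 a0) * (v2 b' - v2 b)"
    using assms(2)[OF a(1,2)] by blast
  obtain b0 b1 where b: "b0 \<in> B" "b1 \<in> B" "v2 b0 \<noteq> v2 b1"
    using not_AE_const_differ[OF nc(2) B1] by blast
  have "u1 a1 - u1 a0 \<noteq> 0" using B2[OF b(1,2)] a b by auto
  define r where "r = (u1 a1 - u1 a0) / (u2 a1 - u2 a0)"
  have r: "r \<noteq> 0" using \<open>u1 a1 - u1 a0 \<noteq> 0\<close> a by (simp add: r_def)
  have v: "v1 b' - v1 b = inverse r * (v2 b' - v2 b)" if "b \<in> B" "b' \<in> B" for b b'
    using B2[OF that] \<open>u1 a1 - u1 a0 \<noteq> 0\<close> a(3) by (simp add: r_def field_simps)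
  have "u1 a - u1 a0 = r * (u2 a - u2 a0)" if aA: "a \<in> A" for a
  proof -
    obtain C where C1: "AE b in lborel. 0 < b \<longrightarrow> b \<in> C"
      and C2: "\<And>b b'. b \<in> C \<Longrightarrow> b' \<in> C \<Longrightarrow>
        (u1 a - u1 a0) * (v1 b' - v1 b) = (u2 a - u2 a0) * (v2 b' - v2 b)"
      using assms(2)[OF a(1) aA] by blast
    \<comment> \<open>The new point \<open>a\<close> has its own exceptional set, so the ratio found
      on \<open>B\<close> can only be compared at points of both sets.\<close>
    have "AE b in lborel. 0 < b \<longrightarrow> b \<in> B \<inter> C" using B1 C1 by eventually_elim auto
    from not_AE_const_differ[OF nc(2) this]
    obtain c0 c1 where c: "c0 \<in> B" "c1 \<in> B" "c0 \<in> C" "c1 \<in> C" "v2 c0 \<noteq> v2 c1" by blast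
    have "(u1 a - u1 a0) * inverse r * (v2 c1 - v2 c0) = (u2 a - u2 a0) * (v2 c1 - v2 c0)"
      using C2[OF c(3,4)] v[OF c(1,2)] by simp
    then have "(u1 a - u1 a0) * inverse r = u2 a - u2 a0" using c(5) by simp
    then show ?thesis using r by (metis mult.commute mult.assoc right_inverse mult_1)
  qed
  then have "AE a in lborel. 0 < a \<longrightarrow> u1 a = r * u2 a + (u1 a0 - r * u2 a0)"
    using A
  proof eventually_elim
    case (elim a)
    then show ?case using \<open>\<And>a. a \<in> A \<Longrightarrow> u1 a - u1 a0 = r * (u2 a - u2 a0)\<close>[of a]
      by (auto simp: algebra_simps)
  qed
  moreover have "AE b in lborel. 0 < b \<longrightarrow> v1 b = inverse r * v2 b + (v1 b0 - inverse r * v2 b0)"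
    using B1
  proof eventually_elim
    case (elim c)
    then show ?case using v[OF b(1), of c] by (auto simp: right_diff_distrib)
  qed
  ultimately show ?thesis using r by blast
qed

text \<open>In the mixed second difference the constant \<open>c\<close> drops out of the
  homogeneity relation. What remains equates products of increments of \<open>T i\<close> and
  \<open>T j\<close> before and after dilation, and these separate.\<close>

lemma pair_statistics_dilation:
  fixes \<Theta> :: "real ^ 'd ^ 'd"
  assumes hom: "log_homogeneous (energy s \<Theta> T)" and d: "CARD('d) \<ge> 3"
    and \<Theta>: "transpose \<Theta> = \<Theta>" "i \<noteq> j" "\<Theta> $ i $ j \<noteq> 0"
    and nc: "\<not> AE_const (T i)" "\<not> AE_const (T j)" and t: "1 \<le> t"
  shows "\<exists>r \<kappa> \<kappa>'. r \<noteq> 0 \<and> (AE a in lborel. 0 < a \<longrightarrow> T i (t * a) = r * T i a + \<kappa>) \<and>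
    (AE b in lborel. 0 < b \<longrightarrow> T j (t * b) = inverse r * T j b + \<kappa>')"
proof -
  let ?e = "\<lambda>y a b. energy s \<Theta> T (upd (upd y i a) j b)"
  define c where "c = (real CARD('d) + 1) * ln t"
  obtain y where "AE a in lborel. AE b in lborel. 0 < a \<longrightarrow> 0 < b \<longrightarrow>
      energy s \<Theta> T (t *\<^sub>R upd (upd y i a) j b) = ?e y a b + c"
    using log_homogeneous_section2[OF hom d t] unfolding c_def by blast
  then have y: "AE a in lborel. AE b in lborel. 0 < a \<longrightarrow> 0 < b \<longrightarrow>
      ?e (t *\<^sub>R y) (t * a) (t * b) = ?e y a b + c"
    by (simp only: scaleR_upd)
  define A where "A = {a. 0 < a \<and> (AE b in lborel. 0 < b \<longrightarrow> ?e (t *\<^sub>R y) (t * a) (t * b) = ?e y a b + c)}"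
  show ?thesis
  proof (rule separate_increments[where A = A, OF _ _ nc])
    show "AE a in lborel. 0 < a \<longrightarrow> a \<in> A"
      using y by (rule eventually_mono) (auto simp: A_def)
    fix a a' assume a: "a \<in> A" "a' \<in> A"
    define B where "B = {b. ?e (t *\<^sub>R y) (t * a) (t * b) = ?e y a b + c \<and>
      ?e (t *\<^sub>R y) (t * a') (t * b) = ?e y a' b + c}"
    have "AE b in lborel. 0 < b \<longrightarrow> ?e (t *\<^sub>R y) (t * a) (t * b) = ?e y a b + c"
      "AE b in lborel. 0 < b \<longrightarrow> ?e (t *\<^sub>R y) (t * a') (t * b) = ?e y a' b + c"
      using a by (simp_all add: A_def)
    then have "AE b in lborel. 0 < b \<longrightarrow> b \<in> B" by eventually_elim (simp add: B_def)
    moreover have "(T i (t * a') - T i (t * a)) * (T j (t * b') - T j (t * b)) =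
        (T i a' - T i a) * (T j b' - T j b)" if "b \<in> B" "b' \<in> B" for b b'
    proof -
      have "2 * \<Theta> $ i $ j * (T i (t * a') - T i (t * a)) * (T j (t * b') - T j (t * b)) =
          2 * \<Theta> $ i $ j * (T i a' - T i a) * (T j b' - T j b)"
        unfolding energy_second_difference[OF \<Theta>(1,2), of s T y a' b' b a, symmetric]
          energy_second_difference[OF \<Theta>(1,2), of s T "t *\<^sub>R y" "t * a'" "t * b'" "t * b" "t * a",
            symmetric]
        using that by (simp add: B_def)
      then show ?thesis using \<Theta>(3) by simp
    qed
    ultimately show "\<exists>B. (AE b in lborel. 0 < b \<longrightarrow> b \<in> B) \<and> (\<forall>b\<in>B. \<forall>b'\<in>B.
      (T i (t * a') - T i (t * a)) * (T j (t * b') - T j (t * b)) = (T i a' - T i a) * (T j b' - T j b))"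
      by blast
  qed
qed

definition dilation_factor :: "(real \<Rightarrow> real) \<Rightarrow> real \<Rightarrow> real \<Rightarrow> bool"
  where "dilation_factor T t r \<longleftrightarrow> (\<exists>\<kappa>. AE a in lborel. 0 < a \<longrightarrow> T (t * a) = r * T a + \<kappa>)"

lemma dilation_factor_unique:
  assumes "\<not> AE_const T" "dilation_factor T t r" "dilation_factor T t r'"
  shows "r = r'"
proof (rule ccontr)
  assume "r \<noteq> r'"
  obtain \<kappa> \<kappa>' where "AE a in lborel. 0 < a \<longrightarrow> T (t * a) = r * T a + \<kappa>"
    "AE a in lborel. 0 < a \<longrightarrow> T (t * a) = r' * T a + \<kappa>'"
    using assms by (auto simp: dilation_factor_def)
  then have "AE a in lborel. 0 < a \<longrightarrow> T a = (\<kappa>' - \<kappa>) / (r - r')"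
  proof eventually_elim
    case (elim a)
    then show ?case using \<open>r \<noteq> r'\<close> by (auto simp: field_simps)
  qed
  then show False using assms(1) by (auto simp: AE_const_def)
qed

lemma dilation_factor_mult:
  assumes "dilation_factor T s r" "dilation_factor T t r'" "0 < t"
  shows "dilation_factor T (s * t) (r * r')"
proof -
  obtain \<kappa> \<kappa>' where *: "AE a in lborel. 0 < a \<longrightarrow> T (s * a) = r * T a + \<kappa>"
    "AE a in lborel. 0 < a \<longrightarrow> T (t * a) = r' * T a + \<kappa>'"
    using assms by (auto simp: dilation_factor_def)
  have "AE a in lborel. 0 < t * a \<longrightarrow> T (s * (t * a)) = r * T (t * a) + \<kappa>"
    using AE_lborel_mult[OF *(1), of t] assms(3) by simp
  with *(2) have "AE a in lborel. 0 < a \<longrightarrow> T (s * t * a) = r * r' * T a + (r * \<kappa>' + \<kappa>)"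
  proof eventually_elim
    case (elim a)
    then show ?case using assms(3) by (auto simp: algebra_simps)
  qed
  then show ?thesis by (auto simp: dilation_factor_def)
qed

text \<open>The factors of three statistics are pairwise inverse to each other, so each of them is
  \<open>1\<close> or \<open>-1\<close>; the factor for \<open>t\<close> is the square of the factor for \<open>sqrt t\<close>.\<close>

lemma log_affine_statistics:
  fixes T :: "'d::finite \<Rightarrow> real \<Rightarrow> real"
  assumes d: "CARD('d) \<ge> 3" and meas: "\<And>i. T i \<in> borel_measurable borel"
    and nc: "\<And>i. \<not> AE_const (T i)"
    and pair: "\<And>i j t. i \<noteq> j \<Longrightarrow> 1 \<le> t \<Longrightarrow>
      \<exists>r. r \<noteq> 0 \<and> dilation_factor (T i) t r \<and> dilation_factor (T j) t (inverse r)"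
  shows "\<exists>\<alpha> \<beta>. AE a in lborel. 0 < a \<longrightarrow> T i a = \<alpha> * ln a + \<beta>"
proof (rule log_affine_if_dilation_increment[OF meas])
  obtain j where j: "j \<noteq> i" using ex_other[of "{i}"] d by auto
  have "card {i, j} \<le> 2" by (simp add: card_insert_if)
  then obtain k where k: "k \<noteq> i" "k \<noteq> j" using ex_other[of "{i, j}"] d by auto
  fix t :: real assume t: "1 \<le> t"
  then have t': "1 \<le> sqrt t" by simp
  obtain r where r: "r \<noteq> 0" "dilation_factor (T i) (sqrt t) r"
      "dilation_factor (T j) (sqrt t) (inverse r)"
    using pair[OF j[symmetric] t'] by blast
  obtain p where p: "p \<noteq> 0" "dilation_factor (T j) (sqrt t) p"
      "dilation_factor (T k) (sqrt t) (inverse p)"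
    using pair[OF k(2)[symmetric] t'] by blast
  obtain q where q: "q \<noteq> 0" "dilation_factor (T i) (sqrt t) q"
      "dilation_factor (T k) (sqrt t) (inverse q)"
    using pair[OF k(1)[symmetric] t'] by blast
  have "q = r" "p = inverse r" "inverse p = inverse q"
    using dilation_factor_unique[OF nc] r p q by blast+
  then have "r * r = 1" using r(1) by (simp add: field_simps)
  then have "dilation_factor (T i) t 1"
    using dilation_factor_mult[OF r(2) r(2)] t by simp
  then show "\<exists>\<kappa>. AE a in lborel. 0 < a \<longrightarrow> T i (t * a) = T i a + \<kappa>"
    by (simp add: dilation_factor_def)
qed

subsection \<open>Pareto laws with an explicit energy\<close>

text \<open>The constant \<open>C\<close> is existential so that additive constants in the energy
  can be discarded. Equality of the marginal probabilities is kept apart and enters only when the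
  linear term is identified.\<close>

definition pareto_energy :: "(real ^ 'd) measure \<Rightarrow> (real ^ 'd \<Rightarrow> real) \<Rightarrow> bool"
  where "pareto_energy M H \<longleftrightarrow> prob_space M \<and> H \<in> borel_measurable borel \<and> log_homogeneous H \<and>
    (\<exists>C>0. M = density lborel (\<lambda>y. ennreal (indicator pareto_support y * (C * exp (- H y)))))"

lemma mem_pareto_support:
  "y \<in> pareto_support \<longleftrightarrow> (\<forall>k. 0 \<le> y $ k) \<and> (\<exists>k. 1 < y $ k)"
  by (simp add: pareto_support_def less_eq_vec_def) (meson not_le)

lemma pareto_support_measurable [measurable]: "pareto_support \<in> sets borel"
  unfolding pareto_support_def by measurable

lemma pareto_supportI: "(\<And>k. 0 < y $ k) \<Longrightarrow> 1 < y $ k \<Longrightarrow> y \<in> pareto_support"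
  by (auto simp: mem_pareto_support less_imp_le)

lemma AE_pareto_support_positive:
  "AE y in lborel. y \<in> (pareto_support :: (real ^ 'd) set) \<longrightarrow> (\<forall>k. 0 < y $ k)"
  using AE_nonzero_coordinates
  by eventually_elim (auto simp: mem_pareto_support less_le)

lemma pareto_energy_cong:
  assumes "pareto_energy M H" and eq: "AE y in lborel. (\<forall>k. 0 < y $ k) \<longrightarrow> H y = H' y"
    and [measurable]: "H' \<in> borel_measurable borel"
  shows "pareto_energy M H'"
proof -
  obtain C where C: "0 < C"
      "M = density lborel (\<lambda>y. ennreal (indicator pareto_support y * (C * exp (- H y))))"
    and [measurable]: "H \<in> borel_measurable borel" and *: "prob_space M" "log_homogeneous H"
    using assms(1) by (auto simp: pareto_energy_def)
  have "AE y in lborel. ennreal (indicator pareto_support y * (C * exp (- H y))) =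
      ennreal (indicator pareto_support y * (C * exp (- H' y)))"
    using AE_pareto_support_positive eq
    by eventually_elim (auto simp: indicator_def)
  then have "M = density lborel (\<lambda>y. ennreal (indicator pareto_support y * (C * exp (- H' y))))"
    unfolding C(2) by (intro density_cong) measurable
  moreover have "log_homogeneous H'" using log_homogeneous_cong[OF *(2) eq] .
  ultimately show ?thesis using *(1) C(1) assms(3) by (auto simp: pareto_energy_def)
qed

lemma pareto_energy_shift:
  assumes "pareto_energy M (\<lambda>y. H y + \<gamma>)"
  shows "pareto_energy M H"
proof -
  obtain C where C: "0 < C"
      "M = density lborel (\<lambda>y. ennreal (indicator pareto_support y * (C * exp (- (H y + \<gamma>)))))"
    and *: "prob_space M" "log_homogeneous (\<lambda>y. H y + \<gamma>)" "(\<lambda>y. H y + \<gamma>) \<in> borel_measurable borel"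
    using assms by (auto simp: pareto_energy_def)
  have "(\<lambda>y. (H y + \<gamma>) - \<gamma>) \<in> borel_measurable borel"
    using *(3) by (rule borel_measurable_diff) simp
  moreover have "M = density lborel (\<lambda>y. ennreal (indicator pareto_support y * (C * exp (- \<gamma>) * exp (- H y))))"
    unfolding C(2) by (simp add: exp_diff exp_minus field_simps)
  moreover have "0 < C * exp (- \<gamma>)" using C by simp
  ultimately show ?thesis using * by (auto simp: pareto_energy_def log_homogeneous_def)
qed

lemma pairwise_weight_eq:
  "pairwise_weight S T \<mu> \<Theta> y = exp (- energy (\<lambda>i a. \<mu> $ i \<bullet> S i a) \<Theta> T y)"
  by (simp add: pairwise_weight_def energy_def quad_def)

lemma quad_measurable [measurable (raw)]:
  "(\<And>i. f i \<in> borel_measurable N) \<Longrightarrow> (\<lambda>y. quad \<Theta> (\<lambda>i. f i y)) \<in> borel_measurable N"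
  unfolding quad_def by measurable

lemma coordinate_measurable [measurable]:
  "(\<lambda>y :: real ^ 'n. y $ i) \<in> borel_measurable borel"
  by (intro borel_measurable_continuous_onI continuous_intros)

lemma energy_measurable [measurable]:
  assumes [measurable]: "\<And>i. s i \<in> borel_measurable borel" "\<And>i. T i \<in> borel_measurable borel"
  shows "energy s \<Theta> T \<in> borel_measurable borel"
  unfolding energy_def[abs_def] by measurable

text \<open>Homogeneity is given for some version \<open>f\<close> of the density, not for the
  exponential formula. The two agree almost everywhere, also after dilation, and taking logarithms
  transfers the relation to the energy.\<close>

lemma pareto_energy_pairwise_law:
  fixes S :: "'d::finite \<Rightarrow> real \<Rightarrow> real ^ 'q::finite" and \<Theta> :: "real ^ 'd ^ 'd"
  assumes pareto: "multivariate_pareto (pairwise_law pareto_support S T \<mu> \<Theta>)"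
    and S [measurable]: "\<And>i. S i \<in> borel_measurable borel" and T [measurable]: "\<And>i. T i \<in> borel_measurable borel"
    and Z: "0 < pairwise_Z pareto_support S T \<mu> \<Theta>"
  shows "pareto_energy (pairwise_law pareto_support S T \<mu> \<Theta>) (energy (\<lambda>i a. \<mu> $ i \<bullet> S i a) \<Theta> T)"
proof -
  let ?L = "pareto_support :: (real ^ 'd) set"
  define H where "H = energy (\<lambda>i a. \<mu> $ i \<bullet> S i a) \<Theta> T"
  define Z where "Z = pairwise_Z pareto_support S T \<mu> \<Theta>"
  have Z0: "0 < Z" using assms(4) by (simp add: Z_def)
  have [measurable]: "H \<in> borel_measurable borel" unfolding H_def by measurable
  have law: "pairwise_law ?L S T \<mu> \<Theta> =
      density lborel (\<lambda>y. ennreal (indicator ?L y * (exp (- H y) / Z)))"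
    by (simp add: pairwise_law_def pairwise_weight_eq H_def Z_def)
  obtain f where [measurable]: "f \<in> borel_measurable borel" and f0: "\<And>y. 0 \<le> f y"
    and f: "pairwise_law ?L S T \<mu> \<Theta> = density lborel (\<lambda>y. ennreal (f y))"
    and hom: "\<And>y t. y \<in> ?L \<Longrightarrow> 1 \<le> t \<Longrightarrow> f (t *\<^sub>R y) = f y / t ^ (CARD('d) + 1)"
    using pareto unfolding multivariate_pareto_def by blast
  have "AE y in lborel. ennreal (indicator ?L y * (exp (- H y) / Z)) = ennreal (f y)"
    using law f by (subst sigma_finite_measure.density_unique_iff[OF sigma_finite_lborel, symmetric]) simp_all
  then have ae: "AE y in lborel. indicator ?L y * (exp (- H y) / Z) = f y"
    by eventually_elim (use f0 Z0 in \<open>simp add: indicator_def\<close>)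
  have "log_homogeneous H"
    unfolding log_homogeneous_def
  proof (intro allI impI)
    fix t :: real assume t: "1 \<le> t"
    have "AE y in lborel. indicator ?L (t *\<^sub>R y) * (exp (- H (t *\<^sub>R y)) / Z) = f (t *\<^sub>R y)"
      using AE_lborel_scaleR[OF ae, of t] t by simp
    with ae show "AE y in lborel. (\<forall>k. 0 < y $ k) \<longrightarrow> (\<exists>k. 1 < y $ k) \<longrightarrow>
        H (t *\<^sub>R y) = H y + (real CARD('d) + 1) * ln t"
    proof eventually_elim
      case (elim y)
      show ?case
      proof (intro impI)
        assume pos: "\<forall>k. 0 < y $ k" and "\<exists>k. 1 < y $ k"
        then obtain k where k: "1 < y $ k" by blast
        have yL: "y \<in> ?L" using pos k by (intro pareto_supportI) auto
        have "1 * 1 < t * y $ k" using t k by (intro mult_le_less_imp_less) auto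
        then have tyL: "t *\<^sub>R y \<in> ?L" using pos t by (intro pareto_supportI[of _ k]) auto
        have "exp (- H (t *\<^sub>R y)) = exp (- H y) / t ^ (CARD('d) + 1)"
          using elim hom[OF yL t] yL tyL Z0 by (simp add: field_simps)
        then have "- H (t *\<^sub>R y) = ln (exp (- H y) / t ^ (CARD('d) + 1))" by (metis ln_exp)
        also have "\<dots> = - H y - real (CARD('d) + 1) * ln t"
          using t by (subst ln_div) (simp_all add: ln_realpow del: power_Suc)
        finally show "H (t *\<^sub>R y) = H y + (real CARD('d) + 1) * ln t" by (simp add: add.commute)
      qed
    qed
  qed
  moreover have "\<exists>C>0. pairwise_law ?L S T \<mu> \<Theta> =
      density lborel (\<lambda>y. ennreal (indicator ?L y * (C * exp (- H y))))"
    unfolding law using Z0 by (intro exI[of _ "1 / Z"]) simp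
  moreover have "prob_space (pairwise_law ?L S T \<mu> \<Theta>)"
    using pareto by (simp add: multivariate_pareto_def)
  ultimately show ?thesis unfolding pareto_energy_def H_def[symmetric] by simp
qed

subsection \<open>Diagonal dilations\<close>

text \<open>Translation by \<open>w\<close> in logarithmic coordinates.\<close>

definition dil :: "real ^ 'd \<Rightarrow> real ^ 'd \<Rightarrow> real ^ 'd"
  where "dil w y = (\<chi> i. exp (w $ i) * y $ i)"

lemma dil_nth [simp]: "dil w y $ i = exp (w $ i) * y $ i"
  by (simp add: dil_def)

lemma dil_measurable [measurable]: "dil w \<in> borel_measurable borel"
  unfolding dil_def[abs_def] by (intro borel_measurable_continuous_onI continuous_intros)

lemma dil_dil_minus [simp]: "dil w (dil (- w) y) = y" "dil (- w) (dil w y) = y"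
  by (simp_all add: vec_eq_iff exp_minus)

lemma nn_integral_dil:
  fixes g :: "real ^ 'd \<Rightarrow> ennreal"
  assumes [measurable]: "g \<in> borel_measurable borel"
  shows "(\<integral>\<^sup>+y. g y \<partial>lborel) = ennreal (exp (\<Sum>i\<in>UNIV. w $ i)) * (\<integral>\<^sup>+y. g (dil w y) \<partial>lborel)"
proof -
  \<comment> \<open>The scaling factors are indexed by basis vectors, as the affine change of
    variables requires; at \<open>axis i 1\<close> the factor is \<open>exp (w $ i)\<close>.\<close>
  define c where "c = (\<lambda>j :: real ^ 'd. exp (w \<bullet> j))"
  have T: "(\<lambda>x. 0 + (\<Sum>j\<in>Basis. (c j * (x \<bullet> j)) *\<^sub>R j)) = dil w"
  proof
    fix x :: "real ^ 'd"
    show "0 + (\<Sum>j\<in>Basis. (c j * (x \<bullet> j)) *\<^sub>R j) = dil w x"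
    proof (rule euclidean_eqI)
      fix b :: "real ^ 'd" assume b: "b \<in> Basis"
      then obtain i where "b = axis i 1" by (auto simp: Basis_vec_def)
      have "(0 + (\<Sum>j\<in>Basis. (c j * (x \<bullet> j)) *\<^sub>R j)) \<bullet> b = c b * (x \<bullet> b)"
        unfolding add_0 by (rule inner_sum_left_Basis[OF b])
      also have "\<dots> = dil w x \<bullet> b"
        unfolding \<open>b = axis i 1\<close> by (simp add: c_def inner_axis)
      finally show "(0 + (\<Sum>j\<in>Basis. (c j * (x \<bullet> j)) *\<^sub>R j)) \<bullet> b = dil w x \<bullet> b" .
    qed
  qed
  have "(\<Prod>j\<in>Basis. \<bar>c j\<bar>) = exp (\<Sum>j\<in>Basis. w \<bullet> j)"
    by (simp add: c_def exp_sum)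
  also have "(\<Sum>j\<in>Basis. w \<bullet> j) = (\<Sum>i\<in>UNIV. w $ i)"
  proof -
    have B: "(Basis :: (real ^ 'd) set) = (\<lambda>i. axis i 1) ` UNIV" by (auto simp: Basis_vec_def)
    have "inj (\<lambda>i. axis i (1 :: real) :: real ^ 'd)" by (auto simp: inj_def axis_eq_axis)
    then show ?thesis unfolding B by (simp add: sum.reindex inner_axis)
  qed
  finally have P: "(\<Prod>j\<in>Basis. \<bar>c j\<bar>) = exp (\<Sum>i\<in>UNIV. w $ i)" .
  have "lborel = density (distr lborel borel (dil w)) (\<lambda>_. ennreal (exp (\<Sum>i\<in>UNIV. w $ i)))"
    using lborel_affine_euclidean[of c 0] unfolding T P by (simp add: c_def)
  then have "(\<integral>\<^sup>+y. g y \<partial>lborel) =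
      (\<integral>\<^sup>+y. g y \<partial>density (distr lborel borel (dil w)) (\<lambda>_. ennreal (exp (\<Sum>i\<in>UNIV. w $ i))))"
    by simp
  also have "\<dots> = ennreal (exp (\<Sum>i\<in>UNIV. w $ i)) * (\<integral>\<^sup>+y. g (dil w y) \<partial>lborel)"
    by (simp add: nn_integral_density nn_integral_distr nn_integral_cmult)
  finally show ?thesis .
qed

lemma pareto_energy_null_set:
  assumes "pareto_energy M H" and B [measurable]: "B \<in> sets borel" and "B \<subseteq> pareto_support"
    and "emeasure M B = 0"
  shows "AE y in lborel. y \<notin> B"
proof -
  obtain C where C: "0 < C"
      "M = density lborel (\<lambda>y. ennreal (indicator pareto_support y * (C * exp (- H y))))"
    and [measurable]: "H \<in> borel_measurable borel"
    using assms(1) by (auto simp: pareto_energy_def)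
  have "B \<in> null_sets M" using assms(4) C(2) by (auto simp: null_sets_def)
  then have "AE y in lborel. y \<in> B \<longrightarrow> ennreal (indicator pareto_support y * (C * exp (- H y))) = 0"
    unfolding C(2) by (subst (asm) null_sets_density_iff) auto
  then show ?thesis
    by eventually_elim (use assms(3) C(1) in \<open>auto simp: indicator_def ennreal_eq_0_iff mult_le_0_iff\<close>)
qed

text \<open>The sets \<open>dil (n w) B\<close> are disjoint, and none of them has less mass than \<open>B\<close>.\<close>

lemma null_set_of_wandering:
  fixes H :: "real ^ 'd \<Rightarrow> real"
  assumes pe: "pareto_energy M H" and B [measurable]: "B \<in> sets borel"
    and w: "\<bar>w $ i\<bar> = 1" and Bi: "\<And>y. y \<in> B \<Longrightarrow> 0 < ln (y $ i) \<and> ln (y $ i) < 1"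
    and pos: "\<And>y k. y \<in> B \<Longrightarrow> 0 < y $ k"
    and supp: "\<And>y n. y \<in> B \<Longrightarrow> \<exists>k. 1 < dil (real n *\<^sub>R w) y $ k"
    and le: "\<And>y n. y \<in> B \<Longrightarrow> H (dil (real n *\<^sub>R w) y) \<le> H y + real n * (\<Sum>k\<in>UNIV. w $ k)"
  shows "AE y in lborel. y \<notin> B"
proof -
  obtain C where C: "0 < C"
      "M = density lborel (\<lambda>y. ennreal (indicator pareto_support y * (C * exp (- H y))))"
    and [measurable]: "H \<in> borel_measurable borel" and "prob_space M"
    using pe by (auto simp: pareto_energy_def)
  interpret prob_space M by fact
  define D where "D n = {y. dil (- (real n *\<^sub>R w)) y \<in> B}" for n
  have D [measurable]: "D n \<in> sets borel" for n
    unfolding D_def by measurable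
  have setsM: "sets M = sets borel" using C(2) by simp
  have inL: "dil (real n *\<^sub>R w) y \<in> pareto_support" if y: "y \<in> B" for y n
  proof -
    obtain k where "1 < dil (real n *\<^sub>R w) y $ k" using supp[OF y] by blast
    then show ?thesis using pos[OF y] by (intro pareto_supportI[of _ k]) simp_all
  qed
  have inL0: "B \<subseteq> pareto_support"
  proof
    fix y assume "y \<in> B"
    then show "y \<in> pareto_support" using inL[of y 0] by (simp add: dil_def)
  qed
  \<comment> \<open>The Jacobian of the dilation makes up for the loss of density: the growth of
    \<open>H\<close> allowed by \<open>le\<close> is exactly the logarithm of that Jacobian.\<close>
  have mass: "emeasure M B \<le> emeasure M (D n)" for n
  proof -
    have "emeasure M B = (\<integral>\<^sup>+y. ennreal (indicator pareto_support y * (C * exp (- H y))) * indicator B y \<partial>lborel)"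
      unfolding C(2) by (subst emeasure_density) auto
    also have "\<dots> \<le> (\<integral>\<^sup>+y. ennreal (exp (\<Sum>k\<in>UNIV. (real n *\<^sub>R w) $ k)) *
        (ennreal (indicator pareto_support (dil (real n *\<^sub>R w) y) * (C * exp (- H (dil (real n *\<^sub>R w) y)))) *
          indicator (D n) (dil (real n *\<^sub>R w) y)) \<partial>lborel)"
    proof (rule nn_integral_mono)
      fix y :: "real ^ 'd"
      show "ennreal (indicator pareto_support y * (C * exp (- H y))) * indicator B y \<le>
        ennreal (exp (\<Sum>k\<in>UNIV. (real n *\<^sub>R w) $ k)) *
        (ennreal (indicator pareto_support (dil (real n *\<^sub>R w) y) * (C * exp (- H (dil (real n *\<^sub>R w) y)))) *
          indicator (D n) (dil (real n *\<^sub>R w) y))"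
      proof (cases "y \<in> B")
        case True
        have "exp (- H y) \<le> exp (real n * (\<Sum>k\<in>UNIV. w $ k)) * exp (- H (dil (real n *\<^sub>R w) y))"
          using le[OF True, of n] by (simp add: exp_add[symmetric])
        then have "C * exp (- H y) \<le>
            exp (real n * (\<Sum>k\<in>UNIV. w $ k)) * (C * exp (- H (dil (real n *\<^sub>R w) y)))"
          using C(1) by (simp add: mult.left_commute)
        then show ?thesis
          using True inL[OF True, of n] inL0 C(1)
          by (auto simp: D_def sum_distrib_left ennreal_mult[symmetric] intro!: ennreal_leI)
      qed simp
    qed
    also have "\<dots> = (\<integral>\<^sup>+y. ennreal (indicator pareto_support y * (C * exp (- H y))) * indicator (D n) y \<partial>lborel)"
      by (subst nn_integral_cmult, measurable)
        (rule nn_integral_dil[symmetric, where g = "\<lambda>y. ennreal (indicator pareto_support y * (C * exp (- H y))) * indicator (D n) y"], measurable)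
    also have "\<dots> = emeasure M (D n)"
      unfolding C(2) by (subst emeasure_density) auto
    finally show ?thesis .
  qed
  have disj: "disjoint_family D"
  proof (unfold disjoint_family_on_def, intro ballI impI)
    fix m n :: nat assume mn: "m \<noteq> n"
    \<comment> \<open>As \<open>w $ i\<close> is a sign, \<open>ln (y $ i) * w $ i\<close> lies in
      the open unit interval centred at \<open>real n + w $ i / 2\<close>. These intervals are
      disjoint for different \<open>n\<close>.\<close>
    have r: "\<bar>ln (y $ i) * w $ i - real n - w $ i / 2\<bar> < 1 / 2" if "y \<in> D n" for y n
    proof -
      define z where "z = dil (- (real n *\<^sub>R w)) y"
      have z: "z \<in> B" using that by (simp add: D_def z_def)
      have "y = dil (real n *\<^sub>R w) z" by (simp add: z_def)
      then have "y $ i = exp (real n * w $ i) * z $ i" by simp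
      then have "ln (y $ i) = real n * w $ i + ln (z $ i)"
        using pos[OF z, of i] by (simp add: ln_mult)
      moreover have "w $ i = 1 \<or> w $ i = - 1" using w by linarith
      ultimately show ?thesis using Bi[OF z] by (auto simp: abs_if)
    qed
    show "D m \<inter> D n = {}"
    proof (rule ccontr)
      assume "D m \<inter> D n \<noteq> {}"
      then obtain y where "y \<in> D m" "y \<in> D n" by blast
      from r[OF this(1)] r[OF this(2)] have "\<bar>real m - real n\<bar> < 1" by linarith
      then show False using mn by linarith
    qed
  qed
  have bound: "real n * measure M B \<le> 1" for n
  proof -
    have "real n * measure M B = (\<Sum>k<n. measure M B)" by simp
    also have "\<dots> \<le> (\<Sum>k<n. measure M (D k))"
      using mass by (intro sum_mono) (simp add: emeasure_eq_measure)
    also have "\<dots> = measure M (\<Union>k<n. D k)"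
      using disj by (intro finite_measure_finite_Union[symmetric])
        (auto simp: setsM disjoint_family_on_def)
    also have "\<dots> \<le> 1" by (rule prob_le_1)
    finally show ?thesis .
  qed
  have "measure M B = 0"
  proof (rule ccontr)
    assume "measure M B \<noteq> 0"
    then have "0 < measure M B" by (simp add: less_le)
    then obtain n where "1 < real n * measure M B" using reals_Archimedean3 by blast
    then show False using bound[of n] by simp
  qed
  then have "emeasure M B = 0" by (simp add: emeasure_eq_measure)
  then show ?thesis using pareto_energy_null_set[OF pe B inL0] by blast
qed

lemma energy_upd:
  "energy s \<Theta> T (upd y i a) =
    (\<Sum>k\<in>-{i}. s k (y $ k)) + s i a + quad \<Theta> ((\<lambda>k. T k (y $ k))(i := T i a))"
proof -
  have "(\<lambda>k. T k (upd y i a $ k)) = (\<lambda>k. T k (y $ k))(i := T i a)" by auto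
  moreover have "(\<Sum>k\<in>UNIV. s k (upd y i a $ k)) = s i a + (\<Sum>k\<in>-{i}. s k (y $ k))"
    by (subst sum.remove[of _ i]) (auto simp: Compl_eq_Diff_UNIV intro!: sum.cong)
  ultimately show ?thesis by (simp add: energy_def)
qed

text \<open>If \<open>T i\<close> is constant, then homogeneity forces the \<open>i\<close>-th coordinate to enter the density
  as a factor \<open>y\<^sub>i powr - \<nu>\<close>, which is not integrable over \<open>{0<..}\<close>.\<close>

lemma statistic_not_AE_const:
  fixes \<Theta> :: "real ^ 'd ^ 'd"
  assumes pe: "pareto_energy M (energy s \<Theta> T)" and d: "CARD('d) \<ge> 2"
    and [measurable]: "\<And>i. s i \<in> borel_measurable borel" "\<And>i. T i \<in> borel_measurable borel"
  shows "\<not> AE_const (T i)"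
proof
  assume "AE_const (T i)"
  then obtain c where c: "AE a in lborel. 0 < a \<longrightarrow> T i a = c" by (auto simp: AE_const_def)
  define T' where "T' = T(i := \<lambda>_. c)"
  have [measurable]: "T' k \<in> borel_measurable borel" for k by (simp add: T'_def)
  have "AE a in lborel. 0 < a \<longrightarrow> T k a = T' k a" for k using c by (cases "k = i") (simp_all add: T'_def)
  then have "AE y in lborel. (\<forall>k. 0 < y $ k) \<longrightarrow> energy s \<Theta> T y = energy s \<Theta> T' y"
    by (intro energy_cong_AE) simp_all
  from pareto_energy_cong[OF pe this] have pe': "pareto_energy M (energy s \<Theta> T')" by simp
  then have hom: "log_homogeneous (energy s \<Theta> T')" by (simp add: pareto_energy_def)
  have T'i: "T' i a = c" for a by (simp add: T'_def)
  have "\<exists>\<nu> \<gamma>. AE a in lborel. 0 < a \<longrightarrow> s i a = \<nu> * ln a + \<gamma>"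
  proof (rule log_affine_summand[OF hom d, where i = i])
    fix t :: real and y :: "real ^ 'd"
    \<comment> \<open>With the \<open>i\<close>-th statistic equal to \<open>c\<close>, the
      coordinate \<open>a\<close> enters the energy only through \<open>s i\<close>; the witness
      collects everything else.\<close>
    show "\<exists>\<kappa>. \<forall>a>0. energy s \<Theta> T' (t *\<^sub>R upd y i a) - energy s \<Theta> T' (upd y i a) =
        s i (t * a) - s i a + \<kappa>"
      unfolding scaleR_upd energy_upd T'i
      by (rule exI[of _ "(\<Sum>k\<in>-{i}. s k ((t *\<^sub>R y) $ k)) + quad \<Theta> ((\<lambda>k. T' k ((t *\<^sub>R y) $ k))(i := c)) -
        (\<Sum>k\<in>-{i}. s k (y $ k)) - quad \<Theta> ((\<lambda>k. T' k (y $ k))(i := c))"]) simp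
  qed simp
  then obtain \<nu> \<gamma> where \<nu>: "AE a in lborel. 0 < a \<longrightarrow> s i a = \<nu> * ln a + \<gamma>" by blast
  define s' where "s' = s(i := \<lambda>a. \<nu> * ln a + \<gamma>)"
  have [measurable]: "s' k \<in> borel_measurable borel" for k by (simp add: s'_def)
  have "AE a in lborel. 0 < a \<longrightarrow> s k a = s' k a" for k using \<nu> by (cases "k = i") (simp_all add: s'_def)
  then have "AE y in lborel. (\<forall>k. 0 < y $ k) \<longrightarrow> energy s \<Theta> T' y = energy s' \<Theta> T' y"
    by (intro energy_cong_AE) simp_all
  from pareto_energy_cong[OF pe' this] have pe'': "pareto_energy M (energy s' \<Theta> T')" by simp
  \<comment> \<open>The \<open>j\<close>-th coordinate is not moved and stays above 1, so the
    dilated sets remain in the support even when the \<open>i\<close>-th coordinate tends to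
    0.\<close>
  obtain j where j: "j \<noteq> i" using ex_other[of "{i}"] d by auto
  \<comment> \<open>Each step changes the energy by \<nu> \<sigma> and the logarithm of the Jacobian
    by \<sigma>. The sign gives \<nu> \<sigma> \<le> \<sigma>: the set moves to infinity or to 0
    according to where the power of the coordinate fails to be integrable.\<close>
  define \<sigma> :: real where "\<sigma> = (if \<nu> \<le> 1 then 1 else - 1)"
  define w :: "real ^ 'd" where "w = axis i \<sigma>"
  define B where "B = {y :: real ^ 'd. \<forall>k. 1 < y $ k \<and> y $ k < exp 1}"
  have B1: "B \<in> sets borel" unfolding B_def by measurable
  have dil_w: "dil (real n *\<^sub>R w) y = upd y i (exp (real n * \<sigma>) * y $ i)" for n y
    by (simp add: vec_eq_iff w_def axis_def)
  have "AE y in lborel. y \<notin> B"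
  proof (rule null_set_of_wandering[OF pe'' B1])
    show "\<bar>w $ i\<bar> = 1" by (simp add: w_def \<sigma>_def axis_def)
    show "0 < ln (y $ i) \<and> ln (y $ i) < 1" if "y \<in> B" for y
    proof -
      have "1 < y $ i" "y $ i < exp 1" using that by (auto simp: B_def)
      then show ?thesis using ln_less_cancel_iff[of "y $ i" "exp 1"] by simp
    qed
    show "0 < y $ k" if "y \<in> B" for y k
      using that less_trans[OF zero_less_one] by (auto simp: B_def)
    show "\<exists>k. 1 < dil (real n *\<^sub>R w) y $ k" if "y \<in> B" for y n
      using that j by (intro exI[of _ j]) (auto simp: dil_w B_def)
    show "energy s' \<Theta> T' (dil (real n *\<^sub>R w) y) \<le> energy s' \<Theta> T' y + real n * (\<Sum>k\<in>UNIV. w $ k)"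
      if "y \<in> B" for y n
    proof -
      have "0 < y $ i" using that less_trans[OF zero_less_one] by (auto simp: B_def)
      have "upd y i (y $ i) = y" by (simp add: vec_eq_iff)
      then have "energy s' \<Theta> T' y = energy s' \<Theta> T' (upd y i (y $ i))" by simp
      then have "energy s' \<Theta> T' (dil (real n *\<^sub>R w) y) - energy s' \<Theta> T' y =
          s' i (exp (real n * \<sigma>) * y $ i) - s' i (y $ i)"
        unfolding dil_w energy_upd T'i by simp
      also have "\<dots> = real n * (\<nu> * \<sigma>)"
        using \<open>0 < y $ i\<close> by (simp add: s'_def ln_mult algebra_simps)
      also have "\<dots> \<le> real n * \<sigma>"
        by (intro mult_left_mono) (auto simp: \<sigma>_def)
      also have "\<sigma> = (\<Sum>k\<in>UNIV. w $ k)"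
        by (simp add: w_def axis_def)
      finally show ?thesis by simp
    qed
  qed
  moreover have "open B"
    unfolding B_def Collect_all_eq
    by (intro open_INT finite ballI open_Collect_conj open_Collect_less continuous_intros)
  moreover have "(\<chi> k. exp (1 / 2)) \<in> B" by (simp add: B_def)
  ultimately show False using AE_imp_ex_in_open by blast
qed

subsection \<open>Reduction to a quadratic form in the logarithms\<close>

definition logv :: "real ^ 'd \<Rightarrow> real ^ 'd"
  where "logv y = (\<chi> i. ln (y $ i))"

lemma logv_nth [simp]: "logv y $ i = ln (y $ i)"
  by (simp add: logv_def)

lemma quad_eq_inner: "quad \<Theta> (\<lambda>i. x $ i) = x \<bullet> (\<Theta> *v x)"
  by (simp add: quad_def inner_vec_def matrix_vector_mult_def sum_distrib_left mult_ac)

text \<open>The linear coefficient \<nu> is still free; for \<nu> equal to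
  \<open>hr_mu \<Theta>\<close> this is the negative logarithm of \<open>hr_weight\<close>.\<close>

definition hr_energy :: "real ^ 'd \<Rightarrow> real ^ 'd ^ 'd \<Rightarrow> real ^ 'd \<Rightarrow> real"
  where "hr_energy \<nu> \<Theta> y = \<nu> \<bullet> logv y + logv y \<bullet> (\<Theta> *v logv y)"

lemma hr_energy_measurable [measurable]: "hr_energy \<nu> \<Theta> \<in> borel_measurable borel"
proof -
  have "hr_energy \<nu> \<Theta> = energy (\<lambda>i a. \<nu> $ i * ln a) \<Theta> (\<lambda>i a. ln a)"
    using quad_eq_inner[of \<Theta> "logv _"]
    by (auto simp: hr_energy_def energy_def inner_vec_def[of \<nu>])
  then show ?thesis by simp
qed

lemma symmetric_nth: "transpose \<Theta> = \<Theta> \<Longrightarrow> \<Theta> $ k $ l = \<Theta> $ l $ k"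
  by (metis transpose_def vec_lambda_beta)

lemma matrix_one_nth: "(\<Theta> *v 1) $ i = (\<Sum>j\<in>UNIV. \<Theta> $ i $ j)" for \<Theta> :: "real ^ 'n ^ 'm"
  by (simp add: matrix_vector_mult_def)

lemma inner_matrix_symmetric:
  fixes \<Theta> :: "real ^ 'd ^ 'd"
  shows "transpose \<Theta> = \<Theta> \<Longrightarrow> x \<bullet> (\<Theta> *v y) = (\<Theta> *v x) \<bullet> y"
  by (metis dot_lmul_matrix vector_transpose_matrix inner_commute transpose_matrix_vector)

text \<open>The two mixed sums coincide by symmetry, hence the factor 2 in the linear term.\<close>

lemma quad_affine:
  fixes \<Theta> :: "real ^ 'd ^ 'd"
  assumes "transpose \<Theta> = \<Theta>"
  shows "quad \<Theta> (\<lambda>i. \<alpha> i * x i + \<beta> i) = quad (\<chi> i j. \<Theta> $ i $ j * \<alpha> i * \<alpha> j) x +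
    (\<Sum>i\<in>UNIV. 2 * \<alpha> i * (\<Sum>j\<in>UNIV. \<Theta> $ i $ j * \<beta> j) * x i) + quad \<Theta> \<beta>"
proof -
  have "(\<Sum>i\<in>UNIV. \<Sum>j\<in>UNIV. \<Theta> $ i $ j * \<beta> i * (\<alpha> j * x j)) =
      (\<Sum>j\<in>UNIV. \<Sum>i\<in>UNIV. \<Theta> $ i $ j * \<beta> i * (\<alpha> j * x j))" by (rule sum.swap)
  also have "\<dots> = (\<Sum>j\<in>UNIV. \<alpha> j * (\<Sum>i\<in>UNIV. \<Theta> $ j $ i * \<beta> i) * x j)"
    by (intro sum.cong refl) (simp add: sum_distrib_left sum_distrib_right mult_ac symmetric_nth[OF assms])
  finally have 1: "(\<Sum>i\<in>UNIV. \<Sum>j\<in>UNIV. \<Theta> $ i $ j * \<beta> i * (\<alpha> j * x j)) =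
      (\<Sum>j\<in>UNIV. \<alpha> j * (\<Sum>i\<in>UNIV. \<Theta> $ j $ i * \<beta> i) * x j)" .
  have 2: "(\<Sum>i\<in>UNIV. \<Sum>j\<in>UNIV. \<Theta> $ i $ j * (\<alpha> i * x i) * \<beta> j) =
      (\<Sum>i\<in>UNIV. \<alpha> i * (\<Sum>j\<in>UNIV. \<Theta> $ i $ j * \<beta> j) * x i)"
    by (intro sum.cong refl) (simp add: sum_distrib_left sum_distrib_right mult_ac)
  have "quad \<Theta> (\<lambda>i. \<alpha> i * x i + \<beta> i) = quad (\<chi> i j. \<Theta> $ i $ j * \<alpha> i * \<alpha> j) x +
      (\<Sum>i\<in>UNIV. \<Sum>j\<in>UNIV. \<Theta> $ i $ j * (\<alpha> i * x i) * \<beta> j) +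
      (\<Sum>i\<in>UNIV. \<Sum>j\<in>UNIV. \<Theta> $ i $ j * \<beta> i * (\<alpha> j * x j)) + quad \<Theta> \<beta>"
    unfolding quad_def sum.distrib[symmetric]
    by (intro sum.cong refl) (simp add: algebra_simps)
  then show ?thesis unfolding 1 2 by (simp add: sum.distrib[symmetric] algebra_simps)
qed

text \<open>Comparing the two sides of homogeneity along the \<open>i\<close>-th coordinate shows that \<open>s i\<close>
  compensates the \<open>i\<close>-th row sum of the rescaled interaction matrix by a term in \<open>(ln a)\<^sup>2\<close>.\<close>

lemma log_affine_main_effect:
  fixes \<Theta> :: "real ^ 'd ^ 'd"
  assumes hom: "log_homogeneous (energy s \<Theta> (\<lambda>i a. \<alpha> i * ln a + \<beta> i))" and d: "CARD('d) \<ge> 2"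
    and \<Theta>: "transpose \<Theta> = \<Theta>" and [measurable]: "s i \<in> borel_measurable borel"
  shows "\<exists>\<nu> \<gamma>. AE a in lborel. 0 < a \<longrightarrow>
    s i a = \<nu> * ln a + \<gamma> - (\<Sum>l\<in>UNIV. \<Theta> $ i $ l * \<alpha> i * \<alpha> l) * (ln a)\<^sup>2"
proof -
  define T where "T = (\<lambda>i a. \<alpha> i * ln a + \<beta> i)"
  define r where "r = (\<Sum>l\<in>UNIV. \<Theta> $ i $ l * \<alpha> i * \<alpha> l)"
  define R where "R = (\<Sum>l\<in>-{i}. \<Theta> $ i $ l * \<alpha> l)"
  have r: "r = \<alpha> i * (\<Theta> $ i $ i * \<alpha> i + R)"
    unfolding r_def R_def
    by (subst sum.remove[of _ i])
      (auto simp: Compl_eq_Diff_UNIV sum_distrib_left algebra_simps intro!: sum.cong)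
  \<comment> \<open>Dilation by \<open>t\<close> adds \<open>2 * r * ln t * ln a\<close> to the
    interaction terms, up to terms free of \<open>a\<close>. This is the increment of
    \<open>r * (ln a)\<^sup>2\<close>, again up to a constant.\<close>
  have "\<exists>\<nu> \<gamma>. AE a in lborel. 0 < a \<longrightarrow> s i a + r * (ln a)\<^sup>2 = \<nu> * ln a + \<gamma>"
  proof (rule log_affine_summand[OF hom[folded T_def] d, where i = i])
    fix t :: real and y :: "real ^ 'd" assume t: "1 \<le> t" and y: "\<forall>k. 0 < y $ k"
    define \<tau> where "\<tau> = ln t"
    define P where "P = (\<Sum>l\<in>-{i}. \<Theta> $ i $ l * T l (y $ l))"
    define c1 where "c1 = (\<Sum>k\<in>-{i}. s k ((t *\<^sub>R y) $ k)) +
      (\<Sum>k\<in>-{i}. \<Sum>l\<in>-{i}. \<Theta> $ k $ l * T k ((t *\<^sub>R y) $ k) * T l ((t *\<^sub>R y) $ l))"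
    define c2 where "c2 = (\<Sum>k\<in>-{i}. s k (y $ k)) +
      (\<Sum>k\<in>-{i}. \<Sum>l\<in>-{i}. \<Theta> $ k $ l * T k (y $ k) * T l (y $ l))"
    have Tt: "T l ((t *\<^sub>R y) $ l) = T l (y $ l) + \<alpha> l * \<tau>" for l
    proof -
      have "0 < y $ l" using y by blast
      then show ?thesis using t by (simp add: T_def \<tau>_def ln_mult algebra_simps)
    qed
    have Pt: "(\<Sum>l\<in>-{i}. \<Theta> $ i $ l * T l ((t *\<^sub>R y) $ l)) = P + \<tau> * R"
      unfolding Tt P_def R_def by (simp add: sum.distrib sum_distrib_left algebra_simps)
    have 1: "energy s \<Theta> T (t *\<^sub>R upd y i a) = c1 + s i (t * a) +
        \<Theta> $ i $ i * (T i (t * a))\<^sup>2 + 2 * T i (t * a) * (P + \<tau> * R)" for a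
      unfolding scaleR_upd energy_upd quad_upd[OF \<Theta>] Pt c1_def by simp
    have 2: "energy s \<Theta> T (upd y i a) = c2 + s i a +
        \<Theta> $ i $ i * (T i a)\<^sup>2 + 2 * T i a * P" for a
      unfolding energy_upd quad_upd[OF \<Theta>] P_def c2_def by simp
    show "\<exists>\<kappa>. \<forall>a>0. energy s \<Theta> T (t *\<^sub>R upd y i a) - energy s \<Theta> T (upd y i a) =
        s i (t * a) + r * (ln (t * a))\<^sup>2 - (s i a + r * (ln a)\<^sup>2) + \<kappa>"
    proof (intro exI allI impI)
      fix a :: real assume a: "0 < a"
      have 3: "T i (t * a) = \<alpha> i * ln a + \<beta> i + \<alpha> i * \<tau>" "T i a = \<alpha> i * ln a + \<beta> i"
        "ln (t * a) = ln a + \<tau>"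
        using a t by (simp_all add: T_def \<tau>_def ln_mult algebra_simps)
      show "energy s \<Theta> T (t *\<^sub>R upd y i a) - energy s \<Theta> T (upd y i a) =
        s i (t * a) + r * (ln (t * a))\<^sup>2 - (s i a + r * (ln a)\<^sup>2) +
        (c1 - c2 + \<Theta> $ i $ i * \<alpha> i * \<tau> * (2 * \<beta> i + \<alpha> i * \<tau>) + 2 * \<tau> * R * (\<beta> i + \<alpha> i * \<tau>) +
          2 * \<alpha> i * \<tau> * P - r * \<tau>\<^sup>2)"
        unfolding 1 2 3 r by (simp add: power2_eq_square algebra_simps)
    qed
  qed measurable
  then obtain \<nu> \<gamma> where "AE a in lborel. 0 < a \<longrightarrow> s i a + r * (ln a)\<^sup>2 = \<nu> * ln a + \<gamma>" by blast
  then have "AE a in lborel. 0 < a \<longrightarrow> s i a = \<nu> * ln a + \<gamma> - r * (ln a)\<^sup>2"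
    by eventually_elim auto
  then show ?thesis unfolding r_def by blast
qed

text \<open>Dilation by 2 adds \<open>ln 2\<close> to every logarithm. The quadratic part does not
  see this because \<Theta> annihilates the ones vector, so the linear part accounts for all of
  \<open>(d + 1) * ln 2\<close>.\<close>

lemma log_homogeneous_hr_energy_sum:
  fixes \<Theta> :: "real ^ 'd ^ 'd"
  assumes hom: "log_homogeneous (hr_energy \<nu> \<Theta>)" and \<Theta>: "transpose \<Theta> = \<Theta>" "\<Theta> *v 1 = 0"
  shows "(\<Sum>i\<in>UNIV. \<nu> $ i) = real CARD('d) + 1"
proof -
  have "AE y in lborel. (\<forall>k. 0 < y $ k) \<longrightarrow> (\<exists>k. 1 < y $ k) \<longrightarrow>
      hr_energy \<nu> \<Theta> (2 *\<^sub>R y) = hr_energy \<nu> \<Theta> y + (real CARD('d) + 1) * ln 2"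
    using hom by (simp add: log_homogeneous_def)
  from ex_of_AE_above_one[OF this] obtain y :: "real ^ 'd" where y: "\<And>k. 1 < y $ k"
    and *: "(\<forall>k. 0 < y $ k) \<longrightarrow> (\<exists>k. 1 < y $ k) \<longrightarrow>
      hr_energy \<nu> \<Theta> (2 *\<^sub>R y) = hr_energy \<nu> \<Theta> y + (real CARD('d) + 1) * ln 2" by blast
  have pos: "0 < y $ k" for k using y[of k] by simp
  have "logv (2 *\<^sub>R y) = logv y + ln 2 *\<^sub>R 1"
    using pos[THEN less_imp_neq] by (auto simp: vec_eq_iff ln_mult)
  moreover have "1 \<bullet> (\<Theta> *v logv y) = 0"
    using \<Theta> by (simp add: inner_matrix_symmetric)
  ultimately have "hr_energy \<nu> \<Theta> (2 *\<^sub>R y) = hr_energy \<nu> \<Theta> y + ln 2 * (\<nu> \<bullet> 1)"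
    using \<Theta>(2) by (simp add: hr_energy_def matrix_vector_right_distrib matrix_vector_mult_scaleR
      inner_add_left inner_add_right)
  then have "ln 2 * (\<nu> \<bullet> 1) = ln 2 * (real CARD('d) + 1)" using * pos y by simp
  then show ?thesis by (simp add: inner_vec_def)
qed

text \<open>Substituting the logarithmic forms of \<open>T\<close> and \<open>s\<close> makes the
  energy quadratic in the logarithms. The offsets \<beta> feed the linear term, and the squares left
  in \<open>s\<close> feed the diagonal.\<close>

lemma pareto_energy_hr_energy:
  fixes \<Theta> :: "real ^ 'd ^ 'd"
  assumes pe: "pareto_energy M (energy s \<Theta> T)" and d: "CARD('d) \<ge> 2" and \<Theta>: "transpose \<Theta> = \<Theta>"
    and [measurable]: "\<And>i. s i \<in> borel_measurable borel" "\<And>i. T i \<in> borel_measurable borel"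
    and T: "\<And>i. AE a in lborel. 0 < a \<longrightarrow> T i a = \<alpha> i * ln a + \<beta> i"
  shows "\<exists>\<nu> \<Theta>'. transpose \<Theta>' = \<Theta>' \<and> \<Theta>' *v 1 = 0 \<and> pareto_energy M (hr_energy \<nu> \<Theta>')"
proof -
  let ?T = "\<lambda>i a. \<alpha> i * ln a + \<beta> i"
  define r where "r i = (\<Sum>l\<in>UNIV. \<Theta> $ i $ l * \<alpha> i * \<alpha> l)" for i
  have "AE y in lborel. (\<forall>k. 0 < y $ k) \<longrightarrow> energy s \<Theta> T y = energy s \<Theta> ?T y"
    using T by (intro energy_cong_AE) simp_all
  from pareto_energy_cong[OF pe this] have pe1: "pareto_energy M (energy s \<Theta> ?T)" by simp
  then have hom: "log_homogeneous (energy s \<Theta> ?T)" by (simp add: pareto_energy_def)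
  have "\<exists>\<nu> \<gamma>. AE a in lborel. 0 < a \<longrightarrow> s i a = \<nu> * ln a + \<gamma> - r i * (ln a)\<^sup>2" for i
    unfolding r_def by (rule log_affine_main_effect[OF hom d \<Theta>]) simp
  then obtain \<nu> \<gamma> where \<nu>: "\<And>i. AE a in lborel. 0 < a \<longrightarrow> s i a = \<nu> i * ln a + \<gamma> i - r i * (ln a)\<^sup>2"
    by metis
  let ?s = "\<lambda>i a. \<nu> i * ln a + \<gamma> i - r i * (ln a)\<^sup>2"
  have "AE y in lborel. (\<forall>k. 0 < y $ k) \<longrightarrow> energy s \<Theta> ?T y = energy ?s \<Theta> ?T y"
    using \<nu> by (intro energy_cong_AE) simp_all
  from pareto_energy_cong[OF pe1 this] have pe2: "pareto_energy M (energy ?s \<Theta> ?T)" by simp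
  \<comment> \<open>The squared logarithms in the main effects subtract from each diagonal entry the
    row sum \<open>r i\<close> of the rescaled matrix, so all row sums become 0.\<close>
  define \<Theta>' :: "real ^ 'd ^ 'd"
    where "\<Theta>' = (\<chi> i j. \<Theta> $ i $ j * \<alpha> i * \<alpha> j - (if i = j then r i else 0))"
  define \<nu>' :: "real ^ 'd" where "\<nu>' = (\<chi> i. \<nu> i + 2 * \<alpha> i * (\<Sum>j\<in>UNIV. \<Theta> $ i $ j * \<beta> j))"
  have "energy ?s \<Theta> ?T y = hr_energy \<nu>' \<Theta>' y + (quad \<Theta> \<beta> + (\<Sum>i\<in>UNIV. \<gamma> i))" for y
  proof -
    have "logv y \<bullet> (\<Theta>' *v logv y) = quad \<Theta>' (\<lambda>i. ln (y $ i))"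
      using quad_eq_inner[of \<Theta>' "logv y"] by simp
    also have "\<dots> = quad (\<chi> i j. \<Theta> $ i $ j * \<alpha> i * \<alpha> j) (\<lambda>i. ln (y $ i)) - (\<Sum>i\<in>UNIV. r i * (ln (y $ i))\<^sup>2)"
    proof -
      have "(\<Sum>j\<in>UNIV. (if i = j then r i else 0) * ln (y $ i) * ln (y $ j)) = r i * (ln (y $ i))\<^sup>2" for i
        by (simp add: power2_eq_square if_distrib[of "\<lambda>x. x * _"] cong: if_cong)
      then show ?thesis by (simp add: quad_def \<Theta>'_def left_diff_distrib sum_subtractf)
    qed
    finally have 1: "logv y \<bullet> (\<Theta>' *v logv y) = \<dots>" .
    have 2: "\<nu>' \<bullet> logv y = (\<Sum>i\<in>UNIV. \<nu>' $ i * ln (y $ i))" by (simp add: inner_vec_def)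
    show ?thesis
      unfolding energy_def hr_energy_def quad_affine[OF \<Theta>] 1 2
      by (simp add: \<nu>'_def sum.distrib sum_subtractf distrib_right)
  qed
  then have "energy ?s \<Theta> ?T = (\<lambda>y. hr_energy \<nu>' \<Theta>' y + (quad \<Theta> \<beta> + (\<Sum>i\<in>UNIV. \<gamma> i)))" by blast
  then have "pareto_energy M (hr_energy \<nu>' \<Theta>')"
    using pareto_energy_shift[of M "hr_energy \<nu>' \<Theta>'"] pe2 by simp
  moreover have "transpose \<Theta>' = \<Theta>'"
    using symmetric_nth[OF \<Theta>] by (simp add: transpose_def \<Theta>'_def vec_eq_iff mult_ac)
  moreover have "\<Theta>' *v 1 = 0"
    by (simp add: vec_eq_iff matrix_one_nth \<Theta>'_def sum_subtractf r_def)
  ultimately show ?thesis by blast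
qed

subsection \<open>Positive definiteness on the orthogonal complement of the diagonal\<close>

lemma logv_dil: "(\<And>k. 0 < y $ k) \<Longrightarrow> logv (dil w y) = logv y + w"
  by (simp add: vec_eq_iff ln_mult less_imp_neq[symmetric])

lemma hr_energy_dil:
  fixes \<Theta> :: "real ^ 'd ^ 'd"
  assumes "transpose \<Theta> = \<Theta>" "\<And>k. 0 < y $ k"
  shows "hr_energy \<nu> \<Theta> (dil w y) =
    hr_energy \<nu> \<Theta> y + \<nu> \<bullet> w + w \<bullet> (\<Theta> *v w) + 2 * ((\<Theta> *v w) \<bullet> logv y)"
  using inner_matrix_symmetric[OF assms(1), of w "logv y"] inner_commute[of "logv y" "\<Theta> *v w"]
  by (simp add: hr_energy_def logv_dil[OF assms(2)] matrix_vector_right_distrib inner_add_left inner_add_right)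

lemma inner_one_eq_sum: "1 \<bullet> v = (\<Sum>k\<in>UNIV. v $ k)" for v :: "real ^ 'd"
  by (simp add: inner_vec_def)

text \<open>Moving by \<open>n\<close> times \<open>v\<close> has Jacobian 1 and changes the energy
  by \<open>n * l y\<close> plus a nonpositive term of order \<open>n\<close> squared. Where
  \<open>l y\<close> is nonpositive too, the set is wandering; \<open>v $ i = 1\<close> keeps it in
  the support.\<close>

lemma nonpositive_direction_null_set:
  fixes \<Theta> :: "real ^ 'd ^ 'd"
  assumes pe: "pareto_energy M (hr_energy \<nu> \<Theta>)" and \<Theta>: "transpose \<Theta> = \<Theta>"
    and v: "v $ i = 1" "1 \<bullet> v = 0" "v \<bullet> (\<Theta> *v v) \<le> 0"
  shows "AE y in lborel. (\<forall>k. 1 < y $ k \<and> y $ k < exp 1) \<longrightarrow>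
    0 < \<nu> \<bullet> v + 2 * ((\<Theta> *v v) \<bullet> logv y)"
proof -
  define l where "l y = \<nu> \<bullet> v + 2 * ((\<Theta> *v v) \<bullet> logv y)" for y
  have "(\<Theta> *v v) \<bullet> logv y = (\<Sum>k\<in>UNIV. (\<Theta> *v v) $ k * ln (y $ k))" for y
    by (simp add: inner_vec_def)
  then have [measurable]: "l \<in> borel_measurable borel" unfolding l_def[abs_def] by simp
  define B where "B = {y. (\<forall>k. 1 < y $ k \<and> y $ k < exp 1) \<and> l y \<le> 0}"
  have B: "B \<in> sets borel" unfolding B_def by measurable
  have pos: "0 < y $ k" if "y \<in> B" for y k
    using that less_trans[OF zero_less_one] by (auto simp: B_def)
  have "AE y in lborel. y \<notin> B"
  proof (rule null_set_of_wandering[OF pe B])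
    show "\<bar>v $ i\<bar> = 1" using v by simp
    show "0 < ln (y $ i) \<and> ln (y $ i) < 1" if "y \<in> B" for y
    proof -
      have "1 < y $ i" "y $ i < exp 1" using that by (auto simp: B_def)
      then show ?thesis using ln_less_cancel_iff[of "y $ i" "exp 1"] by simp
    qed
    show "\<exists>k. 1 < dil (real n *\<^sub>R v) y $ k" if "y \<in> B" for y n
    proof (intro exI[of _ i])
      have "1 < y $ i" using that by (auto simp: B_def)
      then have "1 * 1 < exp (real n) * y $ i" by (intro mult_le_less_imp_less) auto
      then show "1 < dil (real n *\<^sub>R v) y $ i" using v by simp
    qed
    show "hr_energy \<nu> \<Theta> (dil (real n *\<^sub>R v) y) \<le>
        hr_energy \<nu> \<Theta> y + real n * (\<Sum>k\<in>UNIV. v $ k)" if "y \<in> B" for y n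
    proof -
      have "l y \<le> 0" using that by (simp add: B_def)
      then have "real n * l y \<le> 0" by (simp add: mult_nonneg_nonpos)
      moreover have "real n * (real n * (v \<bullet> (\<Theta> *v v))) \<le> 0"
        using v(3) by (simp add: mult_nonneg_nonpos)
      moreover have "hr_energy \<nu> \<Theta> (dil (real n *\<^sub>R v) y) =
          hr_energy \<nu> \<Theta> y + real n * l y + real n * (real n * (v \<bullet> (\<Theta> *v v)))"
        using pos[OF that] unfolding l_def
        by (simp add: hr_energy_dil[OF \<Theta>] matrix_vector_mult_scaleR algebra_simps)
      ultimately show ?thesis using v(2) by (simp add: inner_one_eq_sum)
    qed
  qed (use pos in auto)
  then show ?thesis
    by eventually_elim (auto simp: B_def l_def not_le)
qed

text \<open>A nonzero \<open>v\<close> with coordinate sum 0 has entries of both signs. Dividing by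
  a positive and by a negative entry gives two admissible directions, which force opposite strict
  signs of one and the same expression on an open cube.\<close>

lemma precision_positive:
  fixes \<Theta> :: "real ^ 'd ^ 'd"
  assumes pe: "pareto_energy M (hr_energy \<nu> \<Theta>)" and \<Theta>: "transpose \<Theta> = \<Theta>"
    and v: "1 \<bullet> v = 0" "v \<noteq> 0"
  shows "0 < v \<bullet> (\<Theta> *v v)"
proof (rule ccontr)
  assume "\<not> ?thesis"
  then have le: "v \<bullet> (\<Theta> *v v) \<le> 0" by simp
  have sum0: "(\<Sum>k\<in>UNIV. v $ k) = 0" using v(1) by (simp add: inner_one_eq_sum)
  have ex_pos: "\<exists>i. 0 < u $ i" if "(\<Sum>k\<in>UNIV. u $ k) = 0" "u \<noteq> 0" for u :: "real ^ 'd"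
  proof (rule ccontr)
    assume "\<not> ?thesis"
    then have "\<forall>k\<in>UNIV. - u $ k = 0"
      using that(1) by (subst sum_nonneg_eq_0_iff[symmetric]) (auto simp: not_less sum_negf)
    then show False using that(2) by (simp add: vec_eq_iff)
  qed
  obtain i where i: "0 < v $ i" using ex_pos[OF sum0 v(2)] by blast
  obtain j where j: "v $ j < 0" using ex_pos[of "- v"] sum0 v(2) by (auto simp: sum_negf)
  have *: "AE y in lborel. (\<forall>k. 1 < y $ k \<and> y $ k < exp 1) \<longrightarrow>
      0 < inverse (v $ i) * (\<nu> \<bullet> v + 2 * ((\<Theta> *v v) \<bullet> logv y))" if "v $ i \<noteq> 0" for i
  proof -
    let ?u = "inverse (v $ i) *\<^sub>R v"
    have "?u \<bullet> (\<Theta> *v ?u) = (inverse (v $ i))\<^sup>2 * (v \<bullet> (\<Theta> *v v))"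
      by (simp add: matrix_vector_mult_scaleR power2_eq_square)
    also have "\<dots> \<le> 0" using le by (intro mult_nonneg_nonpos) auto
    finally have "AE y in lborel. (\<forall>k. 1 < y $ k \<and> y $ k < exp 1) \<longrightarrow>
      0 < \<nu> \<bullet> ?u + 2 * ((\<Theta> *v ?u) \<bullet> logv y)"
      using that v(1) by (intro nonpositive_direction_null_set[OF pe \<Theta>, of _ i]) simp_all
    then show ?thesis by (simp add: matrix_vector_mult_scaleR algebra_simps)
  qed
  have "AE y :: real ^ 'd in lborel. \<not> (\<forall>k. 1 < y $ k \<and> y $ k < exp 1)"
    using *[OF less_imp_neq[OF i, symmetric]] *[OF less_imp_neq[OF j]]
  proof eventually_elim
    case (elim y)
    then show ?case using i j by (auto simp: zero_less_mult_iff)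
  qed
  moreover have "open {y :: real ^ 'd. \<forall>k. 1 < y $ k \<and> y $ k < exp 1}"
    unfolding Collect_all_eq
    by (intro open_INT finite ballI open_Collect_conj open_Collect_less continuous_intros)
  moreover have "(\<chi> k. exp (1 / 2)) \<in> {y :: real ^ 'd. \<forall>k. 1 < y $ k \<and> y $ k < exp 1}" by simp
  ultimately show False using AE_imp_ex_in_open by blast
qed

subsection \<open>Precision matrices and their pseudoinverse\<close>

text \<open>With \<open>K\<close> the orthogonal projection onto the diagonal, \<open>\<Theta> + K\<close> is invertible
  and \<open>(\<Theta> + K)\<^sup>-\<^sup>1 - K\<close> is the pseudoinverse.\<close>

lemma precision_pseudoinverse:
  fixes \<Theta> :: "real ^ 'd ^ 'd"
  assumes \<Theta>: "transpose \<Theta> = \<Theta>" "\<Theta> *v 1 = 0"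
    and pd: "\<And>v. 1 \<bullet> v = 0 \<Longrightarrow> v \<noteq> 0 \<Longrightarrow> 0 < v \<bullet> (\<Theta> *v v)"
  shows "transpose (pinv \<Theta>) = pinv \<Theta>" "pinv \<Theta> *v 1 = 0"
    "\<Theta> *v (pinv \<Theta> *v x) = x - ((1 \<bullet> x) / real CARD('d)) *\<^sub>R 1"
proof -
  define K :: "real ^ 'd ^ 'd" where "K = (\<chi> i j. 1 / real CARD('d))"
  have Kv: "K *v x = ((1 \<bullet> x) / real CARD('d)) *\<^sub>R 1" for x
    by (simp add: vec_eq_iff matrix_vector_mult_def K_def inner_one_eq_sum sum_divide_distrib)
  have one: "1 \<bullet> (1 :: real ^ 'd) = real CARD('d)" by (simp add: inner_one_eq_sum)
  have one_\<Theta>: "1 \<bullet> (\<Theta> *v x) = 0" for x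
    using \<Theta> by (simp add: inner_matrix_symmetric)
  have KK: "K ** K = K" and \<Theta>K: "\<Theta> ** K = 0" and K\<Theta>: "K ** \<Theta> = 0"
    by (simp_all add: matrix_eq matrix_vector_mul_assoc[symmetric] Kv one one_\<Theta>
      matrix_vector_mult_scaleR \<Theta>(2))
  have Kt: "transpose K = K" by (simp add: transpose_def K_def)
  \<comment> \<open>Pairing with the ones vector annihilates the \<Theta>-part, so the
    \<open>K\<close>-part shows that \<open>x\<close> is orthogonal to it; there \<Theta> is
    positive.\<close>
  have inj: "x = 0" if "(\<Theta> + K) *v x = 0" for x
  proof -
    have "1 \<bullet> ((\<Theta> + K) *v x) = 1 \<bullet> x"
      by (simp add: matrix_vector_mult_add_rdistrib inner_add_right one_\<Theta> Kv one)
    then have "1 \<bullet> x = 0" using that by simp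
    moreover have "\<Theta> *v x = 0"
      using that \<open>1 \<bullet> x = 0\<close> by (simp add: matrix_vector_mult_add_rdistrib Kv)
    ultimately show ?thesis using pd[of x] by (cases "x = 0") auto
  qed
  have "inj ((*v) (\<Theta> + K))"
    by (rule injI, rule eq_iff_diff_eq_0[THEN iffD2], rule inj)
      (simp add: matrix_vector_mult_diff_distrib)
  then obtain B where BA: "B ** (\<Theta> + K) = mat 1"
    using matrix_left_invertible_injective by blast
  then have AB: "(\<Theta> + K) ** B = mat 1" by (rule matrix_left_right_inverse[THEN iffD1])
  have Bt: "transpose B = B"
  proof -
    have "transpose (\<Theta> + K) = \<Theta> + K"
      using symmetric_nth[OF \<Theta>(1)] by (simp add: transpose_def vec_eq_iff K_def)
    then have "transpose ((\<Theta> + K) ** B) = transpose B ** (\<Theta> + K)"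
      by (simp add: matrix_transpose_mul)
    then have "transpose B ** (\<Theta> + K) = mat 1" by (simp add: AB)
    then have "transpose B ** ((\<Theta> + K) ** B) = B" by (simp add: matrix_mul_assoc)
    then show ?thesis by (simp add: AB)
  qed
  have mat_distrib: "A ** (C - D) = A ** C - A ** D" "(C - D) ** A = C ** A - D ** A"
    "A ** (C + D) = A ** C + A ** D" "(C + D) ** A = C ** A + D ** A"
    for A C D :: "real ^ 'd ^ 'd"
    by (simp_all add: vec_eq_iff matrix_matrix_mult_def algebra_simps sum_subtractf sum.distrib)
  have "(\<Theta> + K) ** K = K" by (simp add: mat_distrib \<Theta>K KK)
  then have BK: "B ** K = K"
    by (metis BA matrix_mul_assoc matrix_mul_lid)
  then have KB: "K ** B = K"
    by (metis Bt Kt matrix_transpose_mul)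
  define X where "X = B - K"
  have \<Theta>eq: "\<Theta> = (\<Theta> + K) - K" by simp
  have \<Theta>X: "\<Theta> ** X = mat 1 - K"
  proof -
    have "\<Theta> ** B = (\<Theta> + K) ** B - K ** B" by (simp add: mat_distrib)
    then show ?thesis by (simp add: X_def mat_distrib(1) AB KB \<Theta>K)
  qed
  have X\<Theta>: "X ** \<Theta> = mat 1 - K"
  proof -
    have "B ** \<Theta> = B ** (\<Theta> + K) - B ** K" by (simp add: mat_distrib)
    then show ?thesis by (simp add: X_def mat_distrib(2) BA BK K\<Theta>)
  qed
  have Xt: "transpose X = X"
    using Bt Kt by (simp add: X_def transpose_def vec_eq_iff)
  have KX: "K ** X = 0" by (simp add: X_def mat_distrib KB KK)
  have "transpose (mat 1 - K) = mat 1 - K"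
    using Kt by (simp add: transpose_def vec_eq_iff mat_def)
  then have "penrose_inverse \<Theta> X"
    unfolding penrose_inverse_def \<Theta>X X\<Theta> by (simp add: mat_distrib K\<Theta> KX)
  then have X: "pinv \<Theta> = X" by (rule pinv_eqI)
  show "transpose (pinv \<Theta>) = pinv \<Theta>" by (simp add: X Xt)
  have "X ** K = 0" by (simp add: X_def mat_distrib BK KK)
  moreover have "K *v 1 = 1" by (simp add: Kv one)
  ultimately show "pinv \<Theta> *v 1 = 0"
    by (metis X matrix_vector_mul_assoc matrix_vector_mult_0)
  have "\<Theta> *v (X *v x) = x - K *v x"
    by (simp add: matrix_vector_mul_assoc \<Theta>X matrix_vector_mult_diff_rdistrib)
  then show "\<Theta> *v (pinv \<Theta> *v x) = x - ((1 \<bullet> x) / real CARD('d)) *\<^sub>R 1"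
    by (simp add: X Kv)
qed

text \<open>Removing the component along the ones vector reduces semidefiniteness to
  \<open>pd\<close>. The rank follows because the pseudoinverse provides preimages for the whole
  orthogonal hyperplane.\<close>

lemma precision_mem:
  fixes \<Theta> :: "real ^ 'd ^ 'd"
  assumes \<Theta>: "transpose \<Theta> = \<Theta>" "\<Theta> *v 1 = 0"
    and pd: "\<And>v. 1 \<bullet> v = 0 \<Longrightarrow> v \<noteq> 0 \<Longrightarrow> 0 < v \<bullet> (\<Theta> *v v)"
  shows "\<Theta> \<in> hr_precision_matrices"
proof -
  have one_\<Theta>: "1 \<bullet> (\<Theta> *v x) = 0" for x
    using \<Theta> by (simp add: inner_matrix_symmetric)
  have psd: "0 \<le> x \<bullet> (\<Theta> *v x)" for x
  proof -
    define u where "u = x - ((1 \<bullet> x) / real CARD('d)) *\<^sub>R 1"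
    have u: "1 \<bullet> u = 0" by (simp add: u_def inner_diff_right inner_one_eq_sum[of 1])
    have x: "x = u + ((1 \<bullet> x) / real CARD('d)) *\<^sub>R 1" by (simp add: u_def)
    have "\<Theta> *v x = \<Theta> *v u"
      by (subst x) (simp add: matrix_vector_right_distrib matrix_vector_mult_scaleR \<Theta>(2))
    then have "x \<bullet> (\<Theta> *v x) = u \<bullet> (\<Theta> *v u)"
      by (subst x) (simp add: inner_add_left one_\<Theta>)
    then show ?thesis using pd[OF u] by (cases "u = 0") auto
  qed
  have "range ((*v) \<Theta>) = {x. 1 \<bullet> x = 0}"
  proof
    show "range ((*v) \<Theta>) \<subseteq> {x. 1 \<bullet> x = 0}" using one_\<Theta> by auto
    show "{x. 1 \<bullet> x = 0} \<subseteq> range ((*v) \<Theta>)"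
    proof
      fix x :: "real ^ 'd" assume "x \<in> {x. 1 \<bullet> x = 0}"
      then have "x = \<Theta> *v (pinv \<Theta> *v x)" using precision_pseudoinverse(3)[OF \<Theta> pd] by simp
      then show "x \<in> range ((*v) \<Theta>)" by (rule range_eqI)
    qed
  qed
  then have "rank \<Theta> = CARD('d) - 1"
    using dim_hyperplane[of "1 :: real ^ 'd"] by (simp add: rank_dim_range)
  then show ?thesis using \<Theta> psd by (simp add: hr_precision_matrices_def)
qed

text \<open>The rows of the pseudoinverse sum to 0, so the variogram applied to the ones vector is d
  times the diagonal of the pseudoinverse plus a multiple of that vector, which \<Theta>
  annihilates.\<close>

lemma hr_mu_eq:
  fixes \<Theta> :: "real ^ 'd ^ 'd"
  assumes "\<Theta> *v 1 = 0" "pinv \<Theta> *v 1 = 0"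
  shows "hr_mu \<Theta> = (1 + 1 / real CARD('d)) *\<^sub>R 1 + (1 / 2) *\<^sub>R (\<Theta> *v (\<chi> i. pinv \<Theta> $ i $ i))"
proof -
  have "(\<Sum>j\<in>UNIV. pinv \<Theta> $ i $ j) = 0" for i
    using assms(2) by (metis matrix_one_nth zero_index)
  then have "hr_variogram \<Theta> *v 1 = (\<Sum>j\<in>UNIV. pinv \<Theta> $ j $ j) *\<^sub>R 1 +
      real CARD('d) *\<^sub>R (\<chi> i. pinv \<Theta> $ i $ i)"
    by (simp add: vec_eq_iff matrix_one_nth hr_variogram_def sum.distrib sum_subtractf
      sum_distrib_left[symmetric])
  then show ?thesis
    using assms(1) by (simp add: hr_mu_def matrix_vector_right_distrib matrix_vector_mult_scaleR)
qed

subsection \<open>Equal marginal masses determine the linear term\<close>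

text \<open>A coordinate along the diagonal: dilating all entries by \<open>exp c\<close> adds
  \<open>c\<close>.\<close>

definition log_mean :: "real ^ 'd \<Rightarrow> real"
  where "log_mean y = (1 \<bullet> logv y) / real CARD('d)"

lemma log_mean_measurable [measurable]: "(log_mean :: real ^ 'd \<Rightarrow> real) \<in> borel_measurable borel"
proof -
  have "log_mean = (\<lambda>y :: real ^ 'd. (\<Sum>k\<in>UNIV. ln (y $ k)) / real CARD('d))"
    by (simp add: fun_eq_iff log_mean_def inner_one_eq_sum)
  also have "\<dots> \<in> borel_measurable borel" by measurable
  finally show ?thesis .
qed

lemma log_mean_dil:
  "(\<And>k. 0 < y $ k) \<Longrightarrow> log_mean (dil w y) = log_mean y + (1 \<bullet> w) / real CARD('d)"
  for y :: "real ^ 'd"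
  by (simp add: log_mean_def logv_dil inner_add_right add_divide_distrib)

text \<open>This inner integral over the diagonal variable produces the weight \<open>y $ k\<close>
  in the slab integral.\<close>

lemma nn_integral_exp_tail:
  assumes "0 < z"
  shows "(\<integral>\<^sup>+c. ennreal (exp (- c)) * indicator {c. 1 < exp c * z} c \<partial>lborel) = ennreal z"
proof -
  have "(1 < exp c * z) = (- ln z < c)" for c
  proof -
    have "(1 < exp c * z) = (ln 1 < ln (exp c * z))"
      using assms by (subst ln_less_cancel_iff) simp_all
    then show ?thesis using assms by (auto simp: ln_mult)
  qed
  then have "(\<integral>\<^sup>+c. ennreal (exp (- c)) * indicator {c. 1 < exp c * z} c \<partial>lborel) =
      (\<integral>\<^sup>+c. ennreal (exp (- c)) * indicator {- ln z ..} c \<partial>lborel)"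
    using AE_lborel_singleton[of "- ln z"]
    by (intro nn_integral_cong_AE) (auto elim!: eventually_mono simp: indicator_def)
  also have "\<dots> = ennreal (0 - (- exp (- (- ln z))))"
  proof (rule nn_integral_FTC_atLeast)
    show "((\<lambda>c::real. - exp (- c)) \<longlongrightarrow> 0) at_top"
      using tendsto_minus[OF filterlim_compose[OF exp_at_bot filterlim_uminus_at_bot_at_top]] by simp
  qed (auto intro!: derivative_eq_intros)
  finally show ?thesis using assms by simp
qed

text \<open>The density formula extended to the open orthant, which is invariant under
  \<open>dil\<close>, unlike the support.\<close>

definition orthant_density :: "real \<Rightarrow> (real ^ 'd \<Rightarrow> real) \<Rightarrow> real ^ 'd \<Rightarrow> ennreal"
  where "orthant_density C H y = ennreal (C * exp (- H y)) * indicator {y. \<forall>k. 0 < y $ k} y"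

lemma orthant_density_measurable [measurable]:
  assumes [measurable]: "H \<in> borel_measurable borel"
  shows "orthant_density C H \<in> borel_measurable borel"
  unfolding orthant_density_def[abs_def] by measurable

lemma orthant_density_dil:
  assumes "0 < C" "(\<And>k. 0 < y $ k) \<Longrightarrow> H (dil w y) = H y + c"
  shows "orthant_density C H (dil w y) = ennreal (exp (- c)) * orthant_density C H y"
proof (cases "\<forall>k. 0 < y $ k")
  case True
  then have "H (dil w y) = H y + c" using assms(2) by blast
  then have "C * exp (- H (dil w y)) = exp (- c) * (C * exp (- H y))"
    by (simp add: exp_add[symmetric] mult.left_commute)
  then show ?thesis using True assms(1) by (simp add: orthant_density_def ennreal_mult mult.left_commute)
next
  case False
  then show ?thesis by (auto simp: orthant_density_def indicator_def zero_less_mult_iff)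
qed

text \<open>Integrating out the diagonal direction turns the mass of \<open>{y. 1 < y\<^sub>k}\<close> into an integral
  over a slab that does not depend on \<open>k\<close>.\<close>

lemma marginal_mass_slab:
  fixes \<Theta> :: "real ^ 'd ^ 'd"
  assumes \<Theta>: "transpose \<Theta> = \<Theta>" "\<Theta> *v 1 = 0" and \<nu>: "(\<Sum>i\<in>UNIV. \<nu> $ i) = real CARD('d) + 1"
    and C: "0 < C"
  defines "g \<equiv> orthant_density C (hr_energy \<nu> \<Theta>)"
  shows "(\<integral>\<^sup>+y. g y * indicator {y. 1 < y $ k} y \<partial>lborel) =
    (\<integral>\<^sup>+y. g y * indicator {y. - 1 < log_mean y \<and> log_mean y < 0} y * ennreal (y $ k) \<partial>lborel)"
proof -
  let ?A = "{y :: real ^ 'd. 1 < y $ k}"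
  let ?S = "{y :: real ^ 'd. - 1 < log_mean y \<and> log_mean y < 0}"
  have [measurable]: "g \<in> borel_measurable borel" unfolding g_def by measurable
  \<comment> \<open>The extra indicator restricts \<open>c\<close> to a unit interval starting at
    \<open>log_mean y\<close>, so integrating it over \<open>c\<close> gives 1.\<close>
  define F where "F c y = g y * indicator ?A y * indicator {m. m < c \<and> c < m + 1} (log_mean y)" for c y
  have F_meas [measurable]: "case_prod F \<in> borel_measurable (lborel \<Otimes>\<^sub>M lborel)"
    unfolding F_def[abs_def] by measurable
  have "(\<integral>\<^sup>+y. g y * indicator ?A y \<partial>lborel) = (\<integral>\<^sup>+y. (\<integral>\<^sup>+c. F c y \<partial>lborel) \<partial>lborel)"
  proof (rule nn_integral_cong)
    fix y :: "real ^ 'd"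
    have "F c y = g y * indicator ?A y * indicator {log_mean y<..<log_mean y + 1} c" for c
      by (simp add: F_def indicator_def)
    then show "g y * indicator ?A y = (\<integral>\<^sup>+c. F c y \<partial>lborel)"
      by (simp add: nn_integral_cmult)
  qed
  also have "\<dots> = (\<integral>\<^sup>+c. (\<integral>\<^sup>+y. F c y \<partial>lborel) \<partial>lborel)"
    by (rule lborel_pair.Fubini'[OF F_meas])
  also have "\<dots> = (\<integral>\<^sup>+c. (\<integral>\<^sup>+y. g y * indicator ?S y *
      (ennreal (exp (- c)) * indicator {c. 1 < exp c * y $ k} c) \<partial>lborel) \<partial>lborel)"
  proof (rule nn_integral_cong)
    fix c :: real
    have [measurable]: "F c \<in> borel_measurable borel" unfolding F_def[abs_def] by measurable
    have dil: "F c (dil (c *\<^sub>R 1) y) = ennreal (exp (- (c * (real CARD('d) + 1)))) *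
        (g y * indicator ?S y * indicator {c. 1 < exp c * y $ k} c)" for y
    proof -
      have "g (dil (c *\<^sub>R 1) y) = ennreal (exp (- (c * (real CARD('d) + 1)))) * g y"
        unfolding g_def
      proof (rule orthant_density_dil[OF C])
        assume pos: "\<And>k. 0 < y $ k"
        have "\<nu> \<bullet> 1 = real CARD('d) + 1" using \<nu> inner_one_eq_sum[of \<nu>] by (simp add: inner_commute)
        then show "hr_energy \<nu> \<Theta> (dil (c *\<^sub>R 1) y) = hr_energy \<nu> \<Theta> y + c * (real CARD('d) + 1)"
          using \<Theta>(2) by (simp add: hr_energy_dil[OF \<Theta>(1) pos] matrix_vector_mult_scaleR)
      qed
      moreover have "indicator {m. m < c \<and> c < m + 1} (log_mean (dil (c *\<^sub>R 1) y)) = (indicator ?S y :: ennreal)"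
        if "g y \<noteq> 0"
      proof -
        have pos: "0 < y $ k" for k
          using that by (auto simp: g_def orthant_density_def indicator_def split: if_splits)
        have "log_mean (dil (c *\<^sub>R 1) y) = log_mean y + c"
          by (simp add: log_mean_dil[OF pos] inner_one_eq_sum)
        then show ?thesis by (auto simp: indicator_def)
      qed
      ultimately show ?thesis
        by (cases "g y = 0") (simp_all add: F_def indicator_def)
    qed
    have "(\<integral>\<^sup>+y. F c y \<partial>lborel) = ennreal (exp (\<Sum>i::'d\<in>UNIV. (c *\<^sub>R 1 :: real ^ 'd) $ i)) *
        (\<integral>\<^sup>+y. F c (dil (c *\<^sub>R 1) y) \<partial>lborel)"
      by (rule nn_integral_dil) measurable
    also have "\<dots> = (\<integral>\<^sup>+y. ennreal (exp (c * real CARD('d))) *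
        (ennreal (exp (- (c * (real CARD('d) + 1)))) *
          (g y * indicator ?S y * indicator {c. 1 < exp c * y $ k} c)) \<partial>lborel)"
      unfolding dil by (subst nn_integral_cmult) (simp_all add: mult.commute)
    also have "\<dots> = (\<integral>\<^sup>+y. g y * indicator ?S y *
      (ennreal (exp (- c)) * indicator {c. 1 < exp c * y $ k} c) \<partial>lborel)"
    proof (rule nn_integral_cong)
      fix y :: "real ^ 'd"
      \<comment> \<open>The Jacobian of the diagonal dilation falls short of the homogeneity factor
        by one power, which leaves \<open>exp (- c)\<close>.\<close>
      have e: "ennreal (exp (c * real CARD('d))) * ennreal (exp (- (c * (real CARD('d) + 1)))) = ennreal (exp (- c))"
        by (simp add: ennreal_mult[symmetric] exp_add[symmetric] algebra_simps)
      show "ennreal (exp (c * real CARD('d))) * (ennreal (exp (- (c * (real CARD('d) + 1)))) *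
          (g y * indicator ?S y * indicator {c. 1 < exp c * y $ k} c)) =
        g y * indicator ?S y * (ennreal (exp (- c)) * indicator {c. 1 < exp c * y $ k} c)"
        unfolding e[symmetric] by (simp only: mult_ac)
    qed
    finally show "(\<integral>\<^sup>+y. F c y \<partial>lborel) = (\<integral>\<^sup>+y. g y * indicator ?S y *
      (ennreal (exp (- c)) * indicator {c. 1 < exp c * y $ k} c) \<partial>lborel)" .
  qed
  also have "\<dots> = (\<integral>\<^sup>+y. (\<integral>\<^sup>+c. g y * indicator ?S y *
      (ennreal (exp (- c)) * indicator {c. 1 < exp c * y $ k} c) \<partial>lborel) \<partial>lborel)"
    by (rule lborel_pair.Fubini') measurable
  also have "\<dots> = (\<integral>\<^sup>+y. g y * indicator ?S y * ennreal (y $ k) \<partial>lborel)"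
  proof (rule nn_integral_cong)
    fix y :: "real ^ 'd"
    show "(\<integral>\<^sup>+c. g y * indicator ?S y *
      (ennreal (exp (- c)) * indicator {c. 1 < exp c * y $ k} c) \<partial>lborel) =
      g y * indicator ?S y * ennreal (y $ k)"
    proof (cases "0 < y $ k")
      case True
      then show ?thesis by (subst nn_integral_cmult) (simp_all add: nn_integral_exp_tail)
    next
      case False
      then have "g y = 0" by (auto simp: g_def orthant_density_def indicator_def)
      then show ?thesis by simp
    qed
  qed
  finally show ?thesis .
qed

text \<open>As \<open>w\<close> sums to 0, the dilation preserves volume and slab. The choice of
  \<open>\<Theta> *v w\<close>, with 1/2 against the factor 2 of the cross term, shifts the energy
  by \<open>ln (y $ l) - ln (y $ k)\<close> plus a constant, which turns the weight
  \<open>y $ l\<close> into \<open>y $ k\<close>.\<close>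

lemma slab_integral_dil:
  fixes \<Theta> :: "real ^ 'd ^ 'd" and \<nu> :: "real ^ 'd"
  assumes \<Theta>: "transpose \<Theta> = \<Theta>" and C: "0 < C" and w: "1 \<bullet> w = 0"
    and \<Theta>w: "\<Theta> *v w = (1 / 2) *\<^sub>R (axis l 1 - axis k 1)"
  defines "g \<equiv> orthant_density C (hr_energy \<nu> \<Theta>)"
    and "I \<equiv> \<lambda>y :: real ^ 'd. indicator {y. - 1 < log_mean y \<and> log_mean y < 0} y :: ennreal"
  shows "(\<integral>\<^sup>+y. g y * I y * ennreal (y $ l) \<partial>lborel) =
    ennreal (exp ((w $ l + w $ k) / 2 - \<nu> \<bullet> w)) * (\<integral>\<^sup>+y. g y * I y * ennreal (y $ k) \<partial>lborel)"
proof -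
  have [measurable]: "g \<in> borel_measurable borel" "I \<in> borel_measurable borel"
    unfolding g_def I_def by measurable
  have "(\<integral>\<^sup>+y. g y * I y * ennreal (y $ l) \<partial>lborel) =
      (\<integral>\<^sup>+y. g (dil w y) * I (dil w y) * ennreal (dil w y $ l) \<partial>lborel)"
    using w by (subst nn_integral_dil[of _ w]) (simp_all add: inner_one_eq_sum)
  also have "\<dots> = (\<integral>\<^sup>+y. ennreal (exp ((w $ l + w $ k) / 2 - \<nu> \<bullet> w)) * (g y * I y * ennreal (y $ k)) \<partial>lborel)"
  proof (rule nn_integral_cong)
    fix y :: "real ^ 'd"
    show "g (dil w y) * I (dil w y) * ennreal (dil w y $ l) =
      ennreal (exp ((w $ l + w $ k) / 2 - \<nu> \<bullet> w)) * (g y * I y * ennreal (y $ k))"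
    proof (cases "\<forall>k. 0 < y $ k")
      case True
      then have pos: "\<And>k. 0 < y $ k" by blast
      define e where "e = \<nu> \<bullet> w + (w $ l - w $ k) / 2 + ln (y $ l) - ln (y $ k)"
      have q: "(\<Theta> *v w) \<bullet> x = (x $ l - x $ k) / 2" for x
        unfolding \<Theta>w by (simp add: inner_diff_left inner_axis')
      have "hr_energy \<nu> \<Theta> (dil w y) =
          hr_energy \<nu> \<Theta> y + (\<nu> \<bullet> w + (w $ l - w $ k) / 2 + ln (y $ l) - ln (y $ k))"
        unfolding hr_energy_dil[OF \<Theta> pos] inner_commute[of w] q by simp
      then have g: "g (dil w y) = ennreal (exp (- e)) * g y"
        unfolding g_def e_def by (intro orthant_density_dil[OF C])
      have I: "I (dil w y) = I y"
        using w by (simp add: I_def log_mean_dil[OF pos] indicator_def)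
      have "exp (- e) * (exp (w $ l) * exp (ln (y $ l))) =
          exp ((w $ l + w $ k) / 2 - \<nu> \<bullet> w) * exp (ln (y $ k))"
        unfolding exp_add[symmetric] e_def by (simp add: field_simps)
      then have e: "ennreal (exp (- e)) * ennreal (dil w y $ l) =
          ennreal (exp ((w $ l + w $ k) / 2 - \<nu> \<bullet> w)) * ennreal (y $ k)"
        using pos by (simp add: ennreal_mult'[symmetric])
      have "g (dil w y) * I (dil w y) * ennreal (dil w y $ l) =
          (ennreal (exp (- e)) * ennreal (dil w y $ l)) * (g y * I y)"
        unfolding g I by (simp only: mult_ac)
      then show ?thesis unfolding e by (simp only: mult_ac)
    next
      case False
      then have "g y = 0" "g (dil w y) = 0"
        by (auto simp: g_def orthant_density_def indicator_def zero_less_mult_iff)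
      then show ?thesis by simp
    qed
  qed
  also have "\<dots> = ennreal (exp ((w $ l + w $ k) / 2 - \<nu> \<bullet> w)) * (\<integral>\<^sup>+y. g y * I y * ennreal (y $ k) \<partial>lborel)"
    by (rule nn_integral_cmult) measurable
  finally show ?thesis .
qed

text \<open>Within \<open>{y. 1 < y $ k}\<close> the support and the open orthant differ only by a
  null set.\<close>

lemma pareto_energy_marginal:
  fixes H :: "real ^ 'd \<Rightarrow> real"
  assumes "pareto_energy M H"
  shows "\<exists>C>0. M = density lborel (\<lambda>y. ennreal (indicator pareto_support y * (C * exp (- H y)))) \<and>
    (\<forall>k. emeasure M {y. 1 < y $ k} = (\<integral>\<^sup>+y. orthant_density C H y * indicator {y. 1 < y $ k} y \<partial>lborel))"
proof -
  obtain C where C: "0 < C"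
      "M = density lborel (\<lambda>y. ennreal (indicator pareto_support y * (C * exp (- H y))))"
    and [measurable]: "H \<in> borel_measurable borel"
    using assms by (auto simp: pareto_energy_def)
  have "emeasure M {y. 1 < y $ k} =
      (\<integral>\<^sup>+y. orthant_density C H y * indicator {y. 1 < y $ k} y \<partial>lborel)" for k
  proof -
    have "emeasure M {y. 1 < y $ k} =
        (\<integral>\<^sup>+y. ennreal (indicator pareto_support y * (C * exp (- H y))) * indicator {y. 1 < y $ k} y \<partial>lborel)"
      unfolding C(2) by (subst emeasure_density) auto
    also have "\<dots> = (\<integral>\<^sup>+y. orthant_density C H y * indicator {y. 1 < y $ k} y \<partial>lborel)"
    proof (rule nn_integral_cong_AE)
      show "AE y in lborel. ennreal (indicator pareto_support y * (C * exp (- H y))) *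
          indicator {y. 1 < y $ k} y = orthant_density C H y * indicator {y. 1 < y $ k} y"
        using AE_pareto_support_positive
      proof eventually_elim
        case (elim y)
        then show ?case
          using pareto_supportI[of y k] by (auto simp: orthant_density_def indicator_def)
      qed
    qed
    finally show ?thesis .
  qed
  then show ?thesis using C by blast
qed

text \<open>Lets the common marginal mass be cancelled when two marginals are compared.\<close>

lemma pareto_energy_marginal_nonzero:
  fixes H :: "real ^ 'd \<Rightarrow> real"
  assumes "pareto_energy M H"
  shows "emeasure M {y. 1 < y $ k} \<noteq> 0"
proof
  assume 0: "emeasure M {y. 1 < y $ k} = 0"
  define B where "B = {y :: real ^ 'd. \<forall>k. 1 < y $ k}"
  have [measurable]: "B \<in> sets borel" unfolding B_def by measurable
  have sets: "sets M = sets borel"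
    using assms by (auto simp: pareto_energy_def)
  have "emeasure M B \<le> emeasure M {y. 1 < y $ k}"
    by (rule emeasure_mono) (auto simp: B_def sets)
  then have "emeasure M B = 0" using 0 by simp
  moreover have "B \<subseteq> pareto_support"
    using less_trans[OF zero_less_one] by (auto simp: B_def intro!: pareto_supportI)
  ultimately have "AE y in lborel. y \<notin> B"
    using pareto_energy_null_set[OF assms] by simp
  then show False using ex_of_AE_above_one[of "\<lambda>y. y \<notin> B"] by (auto simp: B_def)
qed

text \<open>Equal marginals force the factor in \<open>slab_integral_dil\<close> to be 1 for every
  pair of coordinates. This determines \<nu> up to a multiple of the ones vector, and homogeneity
  fixes that multiple.\<close>

lemma linear_term_eq_hr_mu:
  fixes \<Theta> :: "real ^ 'd ^ 'd"
  assumes pe: "pareto_energy M (hr_energy \<nu> \<Theta>)" and \<Theta>: "transpose \<Theta> = \<Theta>" "\<Theta> *v 1 = 0"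
    and eq: "\<And>k l. measure M {y. 1 < y $ k} = measure M {y. 1 < y $ l}"
  shows "\<nu> = hr_mu \<Theta>"
proof -
  interpret prob_space M using pe by (simp add: pareto_energy_def)
  define X where "X = pinv \<Theta>"
  have pd: "\<And>v. 1 \<bullet> v = 0 \<Longrightarrow> v \<noteq> 0 \<Longrightarrow> 0 < v \<bullet> (\<Theta> *v v)"
    by (rule precision_positive[OF pe \<Theta>(1)])
  have pinv: "transpose X = X" "X *v 1 = 0"
      "\<Theta> *v (X *v x) = x - ((1 \<bullet> x) / real CARD('d)) *\<^sub>R 1" for x
    unfolding X_def using precision_pseudoinverse[OF \<Theta> pd] by simp_all
  have X1: "1 \<bullet> (X *v x) = 0" for x using pinv(1,2) by (simp add: inner_matrix_symmetric)
  have sum\<nu>: "(\<Sum>i\<in>UNIV. \<nu> $ i) = real CARD('d) + 1"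
    using pe log_homogeneous_hr_energy_sum[OF _ \<Theta>] by (simp add: pareto_energy_def)
  obtain C where C: "0 < C" and marg: "\<And>k. emeasure M {y. 1 < y $ k} =
      (\<integral>\<^sup>+y. orthant_density C (hr_energy \<nu> \<Theta>) y * indicator {y. 1 < y $ k} y \<partial>lborel)"
    using pareto_energy_marginal[OF pe] by blast
  define u where "u = X *v \<nu> - (1 / 2) *\<^sub>R (\<chi> i. X $ i $ i)"
  have "u $ l = u $ k" for l k
  proof -
    define e :: "real ^ 'd" where "e = axis l 1 - axis k 1"
    define w where "w = (1 / 2) *\<^sub>R (X *v e)"
    have "1 \<bullet> e = 0" by (simp add: e_def inner_diff_right inner_axis)
    then have \<Theta>w: "\<Theta> *v w = (1 / 2) *\<^sub>R e"
      by (simp add: w_def matrix_vector_mult_scaleR pinv(3))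
    have w1: "1 \<bullet> w = 0" by (simp add: w_def X1)
    have "emeasure M {y. 1 < y $ l} =
        ennreal (exp ((w $ l + w $ k) / 2 - \<nu> \<bullet> w)) * emeasure M {y. 1 < y $ k}"
      unfolding marg marginal_mass_slab[OF \<Theta> sum\<nu> C]
      by (rule slab_integral_dil[OF \<Theta>(1) C w1 \<Theta>w[unfolded e_def]])
    then have "measure M {y. 1 < y $ k} = exp ((w $ l + w $ k) / 2 - \<nu> \<bullet> w) * measure M {y. 1 < y $ k}"
      using eq[of k l] by (simp add: emeasure_eq_measure ennreal_mult[symmetric])
    moreover have "measure M {y. 1 < y $ k} \<noteq> 0"
      using pareto_energy_marginal_nonzero[OF pe, of k] by (simp add: emeasure_eq_measure)
    ultimately have *: "\<nu> \<bullet> w = (w $ l + w $ k) / 2" by simp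
    have Xe: "(X *v e) $ i = X $ i $ l - X $ i $ k" for i
      by (simp add: e_def matrix_vector_mult_diff_distrib matrix_vector_mult_basis column_def)
    have "\<nu> \<bullet> (X *v e) = (X *v \<nu>) $ l - (X *v \<nu>) $ k"
    proof -
      have "z \<bullet> e = z $ l - z $ k" for z by (simp add: e_def inner_diff_right inner_axis)
      then show ?thesis using inner_matrix_symmetric[OF pinv(1), of \<nu> e] by simp
    qed
    \<comment> \<open>By symmetry the off-diagonal entries of \<open>X\<close> cancel in
      \<open>w $ l + w $ k\<close>, and only the difference of two diagonal entries survives; hence
      the form of \<open>u\<close>.\<close>
    moreover have "X $ l $ k = X $ k $ l" using symmetric_nth[OF pinv(1)] .
    ultimately show ?thesis using * by (simp add: u_def w_def Xe field_simps)
  qed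
  then have "u = (u $ i) *\<^sub>R 1" for i by (simp add: vec_eq_iff)
  then have "\<Theta> *v u = 0" by (metis \<Theta>(2) matrix_vector_mult_scaleR scaleR_zero_right)
  then have "\<Theta> *v (X *v \<nu>) = (1 / 2) *\<^sub>R (\<Theta> *v (\<chi> i. X $ i $ i))"
    by (simp add: u_def matrix_vector_mult_diff_distrib matrix_vector_mult_scaleR)
  \<comment> \<open>Applying \<Theta> and \<open>X\<close> to \<nu> removes its component along the
    ones vector; that component has coefficient (d+1)/d because the entries of \<nu> sum to
    d+1.\<close>
  then have "\<nu> = ((real CARD('d) + 1) / real CARD('d)) *\<^sub>R 1 + (1 / 2) *\<^sub>R (\<Theta> *v (\<chi> i. X $ i $ i))"
    by (simp add: pinv(3) inner_one_eq_sum sum\<nu> algebra_simps)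
  also have "(real CARD('d) + 1) / real CARD('d) = 1 + 1 / real CARD('d)"
    by (simp add: add_divide_distrib)
  finally show ?thesis using hr_mu_eq[OF \<Theta>(2)] pinv(2) by (simp add: X_def)
qed

section \<open>Assembly of the Huesler--Reiss representation\<close>

lemma hr_family_memI:
  fixes \<Theta> :: "real ^ 'd ^ 'd"
  assumes pe: "pareto_energy M (hr_energy \<nu> \<Theta>)" and pareto: "multivariate_pareto M"
    and \<Theta>: "transpose \<Theta> = \<Theta>" "\<Theta> *v 1 = 0"
  shows "M \<in> hr_family"
proof -
  have "\<nu> = hr_mu \<Theta>"
    using pareto by (intro linear_term_eq_hr_mu[OF pe \<Theta>]) (simp add: multivariate_pareto_def)
  then have "exp (- hr_energy \<nu> \<Theta> y) = hr_weight \<Theta> y" for y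
    by (simp add: hr_weight_def hr_energy_def logv_def Let_def)
  then have "hr_distribution \<Theta> M"
    using pe pareto by (auto simp: pareto_energy_def hr_distribution_def)
  moreover have "\<Theta> \<in> hr_precision_matrices"
    by (rule precision_mem[OF \<Theta>]) (rule precision_positive[OF pe \<Theta>(1)])
  ultimately show ?thesis by (auto simp: hr_family_def)
qed

theorem theorem1:
  fixes P :: "(real ^ 'd) measure set"
    and S :: "'d \<Rightarrow> real \<Rightarrow> real ^ 'q"
    and T :: "'d \<Rightarrow> real \<Rightarrow> real"
    and \<Omega> :: "((real ^ 'q ^ 'd) \<times> (real ^ 'd ^ 'd)) set"
  assumes "CARD('d) \<ge> 3"
    and "\<And>M. M \<in> P \<Longrightarrow> multivariate_pareto M"
    and "pairwise_interaction_model pareto_support S T \<Omega> P"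
  shows "P \<subseteq> hr_family"
proof
  fix M assume M: "M \<in> P"
  let ?s = "\<lambda>\<mu> i a. \<mu> $ i \<bullet> S i a"
  have meas [measurable]: "S i \<in> borel_measurable borel" "T i \<in> borel_measurable borel" for i
    using assms(3) by (auto simp: pairwise_interaction_model_def)
  have sym: "transpose \<Theta> = \<Theta>" if "(\<mu>, \<Theta>) \<in> \<Omega>" for \<mu> \<Theta>
    using assms(3) that by (auto simp: pairwise_interaction_model_def)
  have P: "P = {pairwise_law pareto_support S T \<mu> \<Theta> | \<mu> \<Theta>. (\<mu>, \<Theta>) \<in> \<Omega>}"
    using assms(3) by (simp add: pairwise_interaction_model_def)
  have pe: "pareto_energy (pairwise_law pareto_support S T \<mu> \<Theta>) (energy (?s \<mu>) \<Theta> T)"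
    if "(\<mu>, \<Theta>) \<in> \<Omega>" for \<mu> \<Theta>
  proof (rule pareto_energy_pairwise_law)
    show "multivariate_pareto (pairwise_law pareto_support S T \<mu> \<Theta>)"
      using that P by (intro assms(2)) blast
    show "0 < pairwise_Z pareto_support S T \<mu> \<Theta>"
      using assms(3) that by (auto simp: pairwise_interaction_model_def)
  qed (rule meas)+
  have d: "CARD('d) \<ge> 2" using assms(1) by simp
  obtain \<mu> \<Theta> where \<Omega>: "(\<mu>, \<Theta>) \<in> \<Omega>" "M = pairwise_law pareto_support S T \<mu> \<Theta>"
    using M P by blast
  \<comment> \<open>Nonconstancy is wanted modulo null sets on the positive half-line; it comes from
    the finite mass of \<open>M\<close>.\<close>
  have nc: "\<not> AE_const (T i)" for i
    by (rule statistic_not_AE_const[OF pe[OF \<Omega>(1)] d]) measurable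
  have "\<exists>\<alpha> \<beta>. AE a in lborel. 0 < a \<longrightarrow> T i a = \<alpha> * ln a + \<beta>" for i
  proof (rule log_affine_statistics[OF assms(1) meas(2) nc])
    fix i j :: 'd and t :: real assume ij: "i \<noteq> j" and t: "1 \<le> t"
    \<comment> \<open>The parameter with nonzero interaction depends on the pair and may belong to
      another member of the family. Since \<open>T\<close> is shared, what it reveals about
      \<open>T i\<close> and \<open>T j\<close> also applies to \<open>M\<close>.\<close>
    have "\<forall>i j. i \<noteq> j \<longrightarrow> (\<exists>(\<mu>, \<Theta>)\<in>\<Omega>. \<Theta> $ i $ j \<noteq> 0)"
      using assms(3) by (simp add: pairwise_interaction_model_def)
    with ij obtain \<mu>' \<Theta>' where *: "(\<mu>', \<Theta>') \<in> \<Omega>" "\<Theta>' $ i $ j \<noteq> 0"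
      by blast
    have "log_homogeneous (energy (?s \<mu>') \<Theta>' T)"
      using pe[OF *(1)] by (simp add: pareto_energy_def)
    from pair_statistics_dilation[OF this assms(1) sym[OF *(1)] ij *(2) nc nc t]
    show "\<exists>r. r \<noteq> 0 \<and> dilation_factor (T i) t r \<and> dilation_factor (T j) t (inverse r)"
      unfolding dilation_factor_def by blast
  qed
  then obtain \<alpha> \<beta> where "\<And>i. AE a in lborel. 0 < a \<longrightarrow> T i a = \<alpha> i * ln a + \<beta> i" by metis
  from pareto_energy_hr_energy[OF pe[OF \<Omega>(1)] d sym[OF \<Omega>(1)] _ meas(2) this]
  obtain \<nu> \<Theta>' where "transpose \<Theta>' = \<Theta>'" "\<Theta>' *v 1 = 0" "pareto_energy M (hr_energy \<nu> \<Theta>')"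
    unfolding \<Omega>(2) by auto
  then show "M \<in> hr_family" using assms(2)[OF M] hr_family_memI by blast
qed

end
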